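(* Let $Q$ be any real symmetric positive definite $n\times n$ matrix and let $d\ge 2$ be even. Then $\mathbf{M}_d[Q]^{-1}$ is a Gram matrix of the sum of squares form $(\mathbf{x}^{\mathsf T}Q\mathbf{x})^{d/2}$, that is, $$\mathbf{m}_{d/2}(\mathbf{x})^{\mathsf T}\,\mathbf{M}_d[Q]^{-1}\,\mathbf{m}_{d/2}(\mathbf{x})\;=\;(\mathbf{x}^{\mathsf T}Q\mathbf{x})^{d/2}.$$ Furthermore, $\mathbf{M}_d[Q]=\mathcal{M}_d[G]$, where $\mathcal{M}_d[G]$ is the matrix of degree $d$ moments of the Gaussian-like density $P_G$ associated to $g(\mathbf{x})=\mathbf{m}_{d/2}(\mathbf{x})^{\mathsf T}G\,\mathbf{m}_{d/2}(\mathbf{x})=(\mathbf{x}^{\mathsf T}Q\mathbf{x})^{d/2}$.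
   Context: $n$ is a positive integer. $\mathbf{m}_{d/2}(\mathbf{x})=(\mathbf{x}^{\alpha})_{|\alpha|=d/2}$ is the column vector of all monomials of degree $d/2$ in $\mathbf{x}=(x_1,\dots,x_n)$ (in a fixed order), of length $M=\binom{d/2+n-1}{n-1}$. A Gram matrix of a form $g$ of degree $d$ that is a sum of squares of forms of degree $d/2$ is a positive semi-definite real symmetric $M\times M$ matrix $G$ with $g(\mathbf{x})=\mathbf{m}_{d/2}(\mathbf{x})^{\mathsf T}G\,\mathbf{m}_{d/2}(\mathbf{x})$. For $Q$ positive definite put $$p_Q^{(d)}(\mathbf{y})=\frac{\sqrt{\det(Q)}}{\sigma_d^n\sqrt{(2\pi)^n}}\exp\left(-\frac{\mathbf{y}^{\mathsf T}Q\mathbf{y}}{2\sigma_d^2}\right),\qquad \sigma_d=\left(\frac{\binom{d/2+n-1}{n-1}}{\sqrt{2}^{\,d}\prod_{i=0}^{d/2-1}\left(\frac n2+i\right)}\right)^{1/d},$$ the density of the centered Gaussian distribution on $\mathbb{R}^n$ with covariance matrix $\sigma_d^2Q^{-1}$, and let $$\mathbf{M}_d[Q]=\int_{\mathbb{R}^n}\mathbf{m}_{d/2}(\mathbf{y})\mathbf{m}_{d/2}(\mathbf{y})^{\mathsf T}p_Q^{(d)}(\mathbf{y})\,\mathrm{d}\mathbf{y}=\left(\int_{\mathbb{R}^n}\mathbf{y}^{\alpha+\beta}p_Q^{(d)}(\mathbf{y})\,\mathrm{d}\mathbf{y}\right)_{|\alpha|=|\beta|=d/2}.$$ Let $k>0$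 be defined by $(2k)^{-1}=\binom{d/2+n-1}{n}$. For a form $g(\mathbf{x})=\mathbf{m}_{d/2}(\mathbf{x})^{\mathsf T}G\,\mathbf{m}_{d/2}(\mathbf{x})$ with Gram matrix $G$, positive on $\mathbb{R}^n\setminus\{\mathbf{0}\}$, the Gaussian-like density is $$P_G(\mathbf{y})=\frac{\exp(-k\,g(\mathbf{y}))}{\int_{\mathbb{R}^n}\exp(-k\,g(\mathbf{z}))\,\mathrm{d}\mathbf{z}},$$ which depends on $G$ only through $g$, and its matrix of degree $d$ moments is $\mathcal{M}_d[G]=\int_{\mathbb{R}^n}\mathbf{m}_{d/2}(\mathbf{y})\mathbf{m}_{d/2}(\mathbf{y})^{\mathsf T}P_G(\mathbf{y})\,\mathrm{d}\mathbf{y}$. *)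

theory Defs
  imports "HOL-Analysis.Analysis"
begin

definition multi_exponents :: "nat \<Rightarrow> ('n::finite \<Rightarrow> nat) set" where
  "multi_exponents k = {\<alpha>. (\<Sum>i\<in>UNIV. \<alpha> i) = k}"

(* A fixed order of the multi-indices of degree k, i.e. a numbering of them by the index type 'm of
   the vectors and matrices below. It exists iff CARD('m) is the number of such multi-indices; see
   ex_enumerates_exponents. *)
definition enumerates_exponents :: "('m::finite \<Rightarrow> 'n::finite \<Rightarrow> nat) \<Rightarrow> nat \<Rightarrow> bool" where
  "enumerates_exponents e k \<longleftrightarrow> bij_betw e UNIV (multi_exponents k)"

definition monomial_vec :: "('m::finite \<Rightarrow> 'n::finite \<Rightarrow> nat) \<Rightarrow> real ^ 'n \<Rightarrow> real ^ 'm" where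
  "monomial_vec e x = (\<chi> a. \<Prod>i\<in>UNIV. (x $ i) ^ e a i)"

definition symmetric_mat :: "real ^ 'n ^ 'n \<Rightarrow> bool" where
  "symmetric_mat A \<longleftrightarrow> transpose A = A"

definition pos_def_mat :: "real ^ 'n::finite ^ 'n \<Rightarrow> bool" where
  "pos_def_mat A \<longleftrightarrow> symmetric_mat A \<and> (\<forall>x. x \<noteq> 0 \<longrightarrow> x \<bullet> (A *v x) > 0)"

definition pos_semidef_mat :: "real ^ 'n::finite ^ 'n \<Rightarrow> bool" where
  "pos_semidef_mat A \<longleftrightarrow> symmetric_mat A \<and> (\<forall>x. x \<bullet> (A *v x) \<ge> 0)"

(* Forms are identified with the polynomial functions they define. The degree of g is determined
   by the enumeration e: it is 2 * k if e enumerates the multi-indices of degree k. *)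
definition gram_matrix ::
    "('m::finite \<Rightarrow> 'n::finite \<Rightarrow> nat) \<Rightarrow> (real ^ 'n \<Rightarrow> real) \<Rightarrow> real ^ 'm ^ 'm \<Rightarrow> bool" where
  "gram_matrix e g G \<longleftrightarrow>
     pos_semidef_mat G \<and> (\<forall>x. g x = monomial_vec e x \<bullet> (G *v monomial_vec e x))"

definition moment_matrix ::
    "('m::finite \<Rightarrow> 'n::finite \<Rightarrow> nat) \<Rightarrow> (real ^ 'n \<Rightarrow> real) \<Rightarrow> real ^ 'm ^ 'm" where
  "moment_matrix e p =
     (\<chi> a b. \<integral>y. monomial_vec e y $ a * monomial_vec e y $ b * p y \<partial>lborel)"

definition gauss_sigma :: "'n::finite itself \<Rightarrow> nat \<Rightarrow> real" where
  "gauss_sigma _ d =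
     (real ((d div 2 + CARD('n) - 1) choose (CARD('n) - 1))
        / (sqrt 2 ^ d * (\<Prod>i<d div 2. real CARD('n) / 2 + real i))) powr (1 / real d)"

definition gauss_density :: "nat \<Rightarrow> real ^ 'n::finite ^ 'n \<Rightarrow> real ^ 'n \<Rightarrow> real" where
  "gauss_density d Q y =
     sqrt (det Q) / (gauss_sigma TYPE('n) d ^ CARD('n) * sqrt ((2 * pi) ^ CARD('n)))
       * exp (- (y \<bullet> (Q *v y)) / (2 * (gauss_sigma TYPE('n) d)\<^sup>2))"

definition gauss_moment_matrix ::
    "('m::finite \<Rightarrow> 'n::finite \<Rightarrow> nat) \<Rightarrow> nat \<Rightarrow> real ^ 'n ^ 'n \<Rightarrow> real ^ 'm ^ 'm" where
  "gauss_moment_matrix e d Q = moment_matrix e (gauss_density d Q)"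

(* The solution k of (2 k)^(-1) = binomial (d/2 + n - 1, n). *)
definition gauss_like_k :: "'n::finite itself \<Rightarrow> nat \<Rightarrow> real" where
  "gauss_like_k _ d = 1 / (2 * real ((d div 2 + CARD('n) - 1) choose CARD('n)))"

definition gauss_like_density ::
    "('m::finite \<Rightarrow> 'n::finite \<Rightarrow> nat) \<Rightarrow> nat \<Rightarrow> real ^ 'm ^ 'm \<Rightarrow> real ^ 'n \<Rightarrow> real" where
  "gauss_like_density e d G y =
     (let w = (\<lambda>z. exp (- gauss_like_k TYPE('n) d
                          * (monomial_vec e z \<bullet> (G *v monomial_vec e z))))
      in w y / (\<integral>z. w z \<partial>lborel))"

definition gauss_like_moment_matrix ::
    "('m::finite \<Rightarrow> 'n::finite \<Rightarrow> nat) \<Rightarrow> nat \<Rightarrow> real ^ 'm ^ 'm \<Rightarrow> real ^ 'm ^ 'm" where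
  "gauss_like_moment_matrix e d G = moment_matrix e (gauss_like_density e d G)"

lemma card_multi_exponents:
  "card (multi_exponents k :: ('n::finite \<Rightarrow> nat) set) = (k + CARD('n) - 1) choose (CARD('n) - 1)"
  and finite_multi_exponents: "finite (multi_exponents k :: ('n::finite \<Rightarrow> nat) set)"
proof -
  obtain h :: "nat \<Rightarrow> 'n" where h: "bij_betw h {..<CARD('n)} UNIV"
    using ex_bij_betw_nat_finite[of "UNIV :: 'n set"] by (auto simp: atLeast0LessThan)
  define L where "L = {l :: nat list. length l = CARD('n) \<and> sum_list l = k}"
  define F where "F = (\<lambda>\<alpha> :: 'n \<Rightarrow> nat. map (\<lambda>j. \<alpha> (h j)) [0..<CARD('n)])"
  define g where "g = the_inv_into {..<CARD('n)} h"
  have gh: "g (h j) = j" if "j < CARD('n)" for j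
    using that h by (simp add: g_def bij_betw_def the_inv_into_f_f)
  have hg: "h (g i) = i" for i
    using h by (simp add: g_def f_the_inv_into_f_bij_betw)
  have gl: "g i < CARD('n)" for i
    using bij_betw_the_inv_into[OF h] by (auto simp: g_def bij_betw_def)
  have sumF: "sum_list (F \<alpha>) = (\<Sum>i\<in>UNIV. \<alpha> i)" for \<alpha>
    using sum.reindex_bij_betw[OF h, of \<alpha>]
    by (simp add: F_def interv_sum_list_conv_sum_set_nat atLeast0LessThan)
  have "bij_betw F (multi_exponents k) L"
  proof (rule bij_betw_byWitness[where f' = "\<lambda>l i. l ! g i"])
    show "\<forall>\<alpha>\<in>multi_exponents k. (\<lambda>i. F \<alpha> ! g i) = \<alpha>"
      by (auto simp: F_def gl hg)
    show inv: "\<forall>l\<in>L. F (\<lambda>i. l ! g i) = l"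
      by (auto simp: F_def L_def gh intro!: nth_equalityI)
    show "F ` multi_exponents k \<subseteq> L"
      by (auto simp: L_def sumF multi_exponents_def) (simp add: F_def)
    show "(\<lambda>l i. l ! g i) ` L \<subseteq> multi_exponents k"
    proof
      fix \<alpha> assume "\<alpha> \<in> (\<lambda>l i. l ! g i) ` L"
      then obtain l where l: "l \<in> L" "\<alpha> = (\<lambda>i. l ! g i)" by auto
      then show "\<alpha> \<in> multi_exponents k"
        using inv sumF[of \<alpha>] by (auto simp: multi_exponents_def L_def)
    qed
  qed
  moreover have "card L = (k + CARD('n) - 1) choose k"
    by (simp add: L_def card_length_sum_list)
  moreover have "(k + CARD('n) - 1) choose k = (k + CARD('n) - 1) choose (CARD('n) - 1)"
  proof -
    obtain c where "CARD('n) = Suc c"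
      using zero_less_card_finite[where 'a = 'n] gr0_implies_Suc by blast
    then show ?thesis
      using binomial_symmetric[of k "k + c"] by simp
  qed
  ultimately show *: "card (multi_exponents k :: ('n \<Rightarrow> nat) set) = (k + CARD('n) - 1) choose (CARD('n) - 1)"
    by (simp add: bij_betw_same_card)
  have "(k + CARD('n) - 1) choose (CARD('n) - 1) > 0"
    by simp
  with * show "finite (multi_exponents k :: ('n::finite \<Rightarrow> nat) set)"
    by (metis card_ge_0_finite)
qed

lemma ex_enumerates_exponents:
  "(\<exists>e :: 'm::finite \<Rightarrow> 'n::finite \<Rightarrow> nat. enumerates_exponents e k)
     \<longleftrightarrow> CARD('m) = (k + CARD('n) - 1) choose (CARD('n) - 1)"
  unfolding enumerates_exponents_def card_multi_exponents[symmetric]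
  by (metis bij_betw_iff_card finite_class.finite_UNIV finite_multi_exponents)

end

(* Write q(x) = x^T Q x and s = d/2. For g homogeneous of degree D and h homogeneous of degree r, the
   layer cake formula and scaling give
     int h exp(-k g) = C_h Gamma(a + 1) / k^a,  a = (r + n)/D,  C_h = int_{g <= 1} h.
   The forms q and q^s have the same unit sublevel set, so both moment matrices consist of the numbers
   C_h / C_1 up to a scalar, and the choice of sigma_d and k makes the two scalars agree.
   For the inverse M^(-1), let K(x) = m(x)^T M^(-1) m(x). A linear map R preserving q acts on monomials
   by m(R x) = S m(x), and S M S^T = M because R preserves the measure; hence K(R x) = K(x). As K is
   homogeneous, K = c q^s, and integrating against the density gives trace(M^(-1) M) = c int q^s p,
   where both sides without c equal the number of monomials. *)
theory Submission
  imports Defs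
begin

subsection \<open>Integrals of homogeneous functions\<close>

text \<open>The two scalars are forced by the trace condition. Let B be the number of monomials of
  degree s; the argument for the inverse requires the mean of q^s to be B. For a density
  proportional to exp(-l q) this mean is (n/2)(n/2 + 1)...(n/2 + s - 1) / l^s, and l = 1/(2
  sigma_d^2) makes it B. For a density proportional to exp(-k q^s) it is n/(2 s k), and the
  prescribed k again makes it B, because binom(s+n-1, n) = (s/n) B. The maps R are Q-reflections.
  They act transitively on the level sets of q, and as linear involutions they preserve Lebesgue
  measure, since their volume factor c satisfies c^2 = 1. The determinant formula for volumes serves
  a different purpose: it gives the volume of the ellipsoid {q \<le> 1}, which identifies the
  explicit prefactor of the Gaussian density with the reciprocal of its total mass. Existence of
  M^(-1) rests on the linear independence of monomials as functions.\<close>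

lemma nn_integral_lborel_scaleR:
  fixes f :: "'a::euclidean_space \<Rightarrow> ennreal"
  assumes [measurable]: "f \<in> borel_measurable borel" and c: "c > 0"
  shows "(\<integral>\<^sup>+x. f x \<partial>lborel) = ennreal (c ^ DIM('a)) * (\<integral>\<^sup>+x. f (c *\<^sub>R x) \<partial>lborel)"
  using c by (subst lborel_affine[of c 0])
     (simp_all add: nn_integral_density nn_integral_distr nn_integral_cmult)

text \<open>The dilation by t^(1/D) carries {g \<le> 1} onto {g \<le> t}. Its Jacobian contributes
  t^(n/D), and the homogeneity of \<open>h\<close> contributes t^(r/D).\<close>

lemma nn_integral_sublevel:
  fixes g h :: "'a::euclidean_space \<Rightarrow> real"
  assumes [measurable]: "g \<in> borel_measurable borel" "h \<in> borel_measurable borel"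
    and g: "\<And>c x. c > 0 \<Longrightarrow> g (c *\<^sub>R x) = c ^ D * g x" and D: "D > 0"
    and h: "\<And>c x. c > 0 \<Longrightarrow> h (c *\<^sub>R x) = c ^ r * h x"
    and t: "t > 0"
  shows "(\<integral>\<^sup>+x. ennreal (h x) * indicator {x. g x \<le> t} x \<partial>lborel)
    = ennreal (t powr ((r + DIM('a)) / D)) * (\<integral>\<^sup>+x. ennreal (h x) * indicator {x. g x \<le> 1} x \<partial>lborel)"
proof -
  define c where "c = t powr (1 / D)"
  have c: "c > 0" using t by (simp add: c_def)
  have cD: "c ^ D = t"
    using t D by (simp add: c_def powr_powr flip: powr_realpow)
  have ca: "c ^ DIM('a) * c ^ r = t powr ((r + DIM('a)) / D)"
    using t by (simp add: c_def powr_powr add_divide_distrib powr_add flip: powr_realpow)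
  have "(\<integral>\<^sup>+x. ennreal (h x) * indicator {x. g x \<le> t} x \<partial>lborel)
      = ennreal (c ^ DIM('a)) * (\<integral>\<^sup>+x. ennreal (h (c *\<^sub>R x)) * indicator {x. g x \<le> t} (c *\<^sub>R x) \<partial>lborel)"
    by (rule nn_integral_lborel_scaleR) (use c in auto)
  also have "(\<integral>\<^sup>+x. ennreal (h (c *\<^sub>R x)) * indicator {x. g x \<le> t} (c *\<^sub>R x) \<partial>lborel)
      = (\<integral>\<^sup>+x. ennreal (c ^ r) * (ennreal (h x) * indicator {x. g x \<le> 1} x) \<partial>lborel)"
    using c t by (intro nn_integral_cong)
      (auto simp: g h cD ennreal_mult' mult.assoc split: split_indicator)
  also have "\<dots> = ennreal (c ^ r) * (\<integral>\<^sup>+x. ennreal (h x) * indicator {x. g x \<le> 1} x \<partial>lborel)"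
    by (rule nn_integral_cmult) auto
  finally show ?thesis
    using c by (simp add: mult.assoc[symmetric] ca flip: ennreal_mult')
qed

text \<open>Below, \<open>ennreal (h x)\<close> truncates negative values to 0, so that these identities apply to the
  positive and the negative part of a signed homogeneous function separately.\<close>

lemma nn_integral_layer_cake_homogeneous:
  fixes g h :: "'a::euclidean_space \<Rightarrow> real" and w :: "real \<Rightarrow> ennreal"
  assumes [measurable]: "g \<in> borel_measurable borel" "h \<in> borel_measurable borel"
      "w \<in> borel_measurable borel"
    and g: "\<And>c x. c > 0 \<Longrightarrow> g (c *\<^sub>R x) = c ^ D * g x" and D: "D > 0"
    and h: "\<And>c x. c > 0 \<Longrightarrow> h (c *\<^sub>R x) = c ^ r * h x"
  shows "(\<integral>\<^sup>+x. ennreal (h x) * (\<integral>\<^sup>+t. w t * indicator {t. 0 < t \<and> g x \<le> t} t \<partial>lborel) \<partial>lborel)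
    = (\<integral>\<^sup>+x. ennreal (h x) * indicator {x. g x \<le> 1} x \<partial>lborel)
      * (\<integral>\<^sup>+t. w t * indicator {0<..} t * ennreal (t powr ((r + DIM('a)) / D)) \<partial>lborel)"
    (is "_ = ?C * _")
proof -
  have "(\<integral>\<^sup>+x. ennreal (h x) * (\<integral>\<^sup>+t. w t * indicator {t. 0 < t \<and> g x \<le> t} t \<partial>lborel) \<partial>lborel)
    = (\<integral>\<^sup>+x. (\<integral>\<^sup>+t. ennreal (h x) * (w t * indicator {t. 0 < t \<and> g x \<le> t} t) \<partial>lborel) \<partial>lborel)"
    by (intro nn_integral_cong nn_integral_cmult[symmetric]) auto
  also have "\<dots> = (\<integral>\<^sup>+t. (\<integral>\<^sup>+x. ennreal (h x) * (w t * indicator {t. 0 < t \<and> g x \<le> t} t) \<partial>lborel) \<partial>lborel)"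
  proof (rule lborel_pair.Fubini')
    \<comment> \<open>Joint measurability is checked on the indicator of one fixed set of pairs; in
      the integrand the set varies with x.\<close>
    have "(\<lambda>(t, x). ennreal (h x) * (w t * indicator {p. 0 < fst p \<and> g (snd p) \<le> fst p} (t, x)))
        \<in> borel_measurable (lborel \<Otimes>\<^sub>M lborel)"
      by measurable
    then show "(\<lambda>(t, x). ennreal (h x) * (w t * indicator {t. 0 < t \<and> g x \<le> t} t))
        \<in> borel_measurable (lborel \<Otimes>\<^sub>M lborel)"
      by (simp add: indicator_def)
  qed
  \<comment> \<open>After the swap the inner integral runs over a sublevel set, so its dependence on
    t is an explicit power.\<close>
  also have "\<dots> = (\<integral>\<^sup>+t. ?C * (w t * indicator {0<..} t * ennreal (t powr ((r + DIM('a)) / D))) \<partial>lborel)"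
  proof (rule nn_integral_cong)
    fix t :: real
    show "(\<integral>\<^sup>+x. ennreal (h x) * (w t * indicator {t. 0 < t \<and> g x \<le> t} t) \<partial>lborel)
      = ?C * (w t * indicator {0<..} t * ennreal (t powr ((r + DIM('a)) / D)))"
    proof (cases "t > 0")
      case True
      have "(\<integral>\<^sup>+x. ennreal (h x) * (w t * indicator {t. 0 < t \<and> g x \<le> t} t) \<partial>lborel)
        = (\<integral>\<^sup>+x. w t * (ennreal (h x) * indicator {x. g x \<le> t} x) \<partial>lborel)"
        using True by (intro nn_integral_cong) (auto split: split_indicator simp: mult.commute)
      also have "\<dots> = w t * (\<integral>\<^sup>+x. ennreal (h x) * indicator {x. g x \<le> t} x \<partial>lborel)"
        by (rule nn_integral_cmult) auto
      also note nn_integral_sublevel[OF assms(1,2) g D h True]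
      finally show ?thesis
        using True by (simp add: ac_simps)
    qed simp
  qed
  also have "\<dots> = ?C * (\<integral>\<^sup>+t. w t * indicator {0<..} t * ennreal (t powr ((r + DIM('a)) / D)) \<partial>lborel)"
    by (rule nn_integral_cmult) auto
  finally show ?thesis .
qed

text \<open>This is Euler's integral after the substitution of k t for t, written with the open
  half-line that the layer cake formula produces.\<close>

lemma nn_integral_Gamma_scaled:
  fixes a k :: real
  assumes "a \<ge> 0" "k > 0"
  shows "(\<integral>\<^sup>+t. ennreal (k * exp (- k * t)) * indicator {0<..} t * ennreal (t powr a) \<partial>lborel)
    = ennreal (Gamma (a + 1) / k powr a)"
proof -
  have "ennreal (Gamma (a + 1)) = (\<integral>\<^sup>+t. ennreal (indicator {0..} t * t powr a / exp t) \<partial>lborel)"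
    using Gamma_conv_nn_integral_real[of "a + 1"] assms by simp
  also have "\<dots> = ennreal k * (\<integral>\<^sup>+t. ennreal (indicator {0..} (k * t) * (k * t) powr a / exp (k * t)) \<partial>lborel)"
    using nn_integral_real_affine[of "\<lambda>t. ennreal (indicator {0..} t * t powr a / exp t)" k 0] assms
    by simp
  also have "\<dots> = (\<integral>\<^sup>+t. ennreal k * ennreal (indicator {0..} (k * t) * (k * t) powr a / exp (k * t)) \<partial>lborel)"
    by (rule nn_integral_cmult[symmetric]) auto
  also have "\<dots> = (\<integral>\<^sup>+t. ennreal (k powr a) * (ennreal (k * exp (- k * t)) * indicator {0<..} t * ennreal (t powr a)) \<partial>lborel)"
  proof (rule nn_integral_cong_AE)
    \<comment> \<open>Discarding t = 0 leaves t > 0, where the integrands are compared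
      algebraically, and t < 0, where both indicators vanish.\<close>
    have "AE t in lborel. t \<noteq> (0::real)" by (rule AE_lborel_singleton)
    then show "AE t in lborel. ennreal k * ennreal (indicator {0..} (k * t) * (k * t) powr a / exp (k * t))
      = ennreal (k powr a) * (ennreal (k * exp (- k * t)) * indicator {0<..} t * ennreal (t powr a))"
    proof eventually_elim
      case (elim t)
      show ?case
      proof (cases "t > 0")
        case True
        then show ?thesis
          using assms by (simp add: powr_mult exp_minus divide_inverse ac_simps flip: ennreal_mult)
      next
        case False
        with elim have "k * t < 0" using assms by (simp add: mult_pos_neg)
        then show ?thesis using False by simp
      qed
    qed
  qed
  also have "\<dots> = ennreal (k powr a) * (\<integral>\<^sup>+t. ennreal (k * exp (- k * t)) * indicator {0<..} t * ennreal (t powr a) \<partial>lborel)"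
    (is "_ = _ * ?I") by (rule nn_integral_cmult) auto
  finally have eq: "ennreal (Gamma (a + 1)) = ennreal (k powr a) * ?I" .
  have "ennreal (Gamma (a + 1) / k powr a) = ennreal (inverse (k powr a)) * ennreal (Gamma (a + 1))"
    using assms by (simp add: divide_inverse mult.commute flip: ennreal_mult')
  also have "\<dots> = ennreal (inverse (k powr a) * k powr a) * ?I"
    unfolding eq by (simp add: ennreal_mult mult.assoc)
  also have "\<dots> = ?I" using assms by simp
  finally show ?thesis by simp
qed

text \<open>Working in the extended nonnegative reals lets the identity cover infinite integrals as
  well, so that integrability can later be read off from it.\<close>

lemma nn_integral_exp_neg_homogeneous:
  fixes g h :: "'a::euclidean_space \<Rightarrow> real"
  assumes [measurable]: "g \<in> borel_measurable borel" "h \<in> borel_measurable borel"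
    and g: "\<And>c x. c > 0 \<Longrightarrow> g (c *\<^sub>R x) = c ^ D * g x" and D: "D > 0"
    and h: "\<And>c x. c > 0 \<Longrightarrow> h (c *\<^sub>R x) = c ^ r * h x"
    and nonneg: "\<And>x. g x \<ge> 0" and k: "k > 0"
  shows "(\<integral>\<^sup>+x. ennreal (h x * exp (- k * g x)) \<partial>lborel)
    = (\<integral>\<^sup>+x. ennreal (h x) * indicator {x. g x \<le> 1} x \<partial>lborel)
      * ennreal (Gamma ((r + DIM('a)) / D + 1) / k powr ((r + DIM('a)) / D))"
proof -
  \<comment> \<open>layer cake weight: \<open>exp (- k u)\<close> is the integral of \<open>k exp (- k t)\<close> over \<open>t \<ge> u\<close>\<close>
  have tail: "(\<integral>\<^sup>+t. ennreal (k * exp (- k * t)) * indicator {t. 0 < t \<and> g x \<le> t} t \<partial>lborel)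
    = ennreal (exp (- k * g x))" for x
  proof -
    have "(\<integral>\<^sup>+t. ennreal (k * exp (- k * t)) * indicator {t. 0 < t \<and> g x \<le> t} t \<partial>lborel)
      = (\<integral>\<^sup>+t. ennreal (k * exp (- k * t)) * indicator {g x..} t \<partial>lborel)"
    proof (rule nn_integral_cong_AE)
      have "AE t in lborel. t \<noteq> (0::real)" by (rule AE_lborel_singleton)
      then show "AE t in lborel. ennreal (k * exp (- k * t)) * indicator {t. 0 < t \<and> g x \<le> t} t
        = ennreal (k * exp (- k * t)) * indicator {g x..} t"
        by eventually_elim (use nonneg[of x] in \<open>auto split: split_indicator\<close>)
    qed
    also have "\<dots> = ennreal (0 - (- exp (- k * g x)))"
    proof (rule nn_integral_FTC_atLeast)
      show "((\<lambda>t. - exp (- k * t)) has_real_derivative k * exp (- k * t)) (at t)" for t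
        by (auto intro!: derivative_eq_intros)
      have "LIM t at_top. k * t :> at_top"
        using k by (simp add: filterlim_tendsto_pos_mult_at_top[OF tendsto_const] filterlim_ident)
      then have "((\<lambda>t. exp (- (k * t))) \<longlongrightarrow> 0) at_top"
        by (intro filterlim_compose[OF exp_at_bot]) (simp add: filterlim_uminus_at_top)
      then show "((\<lambda>t. - exp (- k * t)) \<longlongrightarrow> 0) at_top"
        using tendsto_minus[of "\<lambda>t. exp (- (k * t))" 0] by simp
    qed (use k in auto)
    finally show ?thesis by simp
  qed
  have "(\<integral>\<^sup>+x. ennreal (h x * exp (- k * g x)) \<partial>lborel)
    = (\<integral>\<^sup>+x. ennreal (h x) * (\<integral>\<^sup>+t. ennreal (k * exp (- k * t)) * indicator {t. 0 < t \<and> g x \<le> t} t \<partial>lborel) \<partial>lborel)"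
    unfolding tail by (simp add: ennreal_mult'')
  also note nn_integral_layer_cake_homogeneous[OF assms(1,2) _ g D h]
  also note nn_integral_Gamma_scaled[OF _ k]
  finally show ?thesis by simp
qed

text \<open>The functions \<open>h\<close>, its negative and its absolute value are all homogeneous
  of degree r. The identity for the absolute value yields integrability; those for \<open>h\<close>
  and its negative yield the positive and the negative part of the integral.\<close>

lemma
  fixes g h :: "'a::euclidean_space \<Rightarrow> real"
  assumes [measurable]: "g \<in> borel_measurable borel" "h \<in> borel_measurable borel"
    and g: "\<And>c x. c > 0 \<Longrightarrow> g (c *\<^sub>R x) = c ^ D * g x" and D: "D > 0"
    and h: "\<And>c x. c > 0 \<Longrightarrow> h (c *\<^sub>R x) = c ^ r * h x"
    and nonneg: "\<And>x. g x \<ge> 0" and k: "k > 0"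
    and int: "integrable lborel (\<lambda>x. h x * indicator {x. g x \<le> 1} x)"
  shows integrable_exp_neg_homogeneous: "integrable lborel (\<lambda>x. h x * exp (- k * g x))"
    and integral_exp_neg_homogeneous: "(\<integral>x. h x * exp (- k * g x) \<partial>lborel)
    = (\<integral>x. h x * indicator {x. g x \<le> 1} x \<partial>lborel)
      * (Gamma ((r + DIM('a)) / D + 1) / k powr ((r + DIM('a)) / D))"
proof -
  define c where "c = Gamma ((r + DIM('a)) / D + 1) / k powr ((r + DIM('a)) / D)"
  have c: "c \<ge> 0" using k by (simp add: c_def Gamma_real_pos less_imp_le add_nonneg_pos)
  have eq: "(\<integral>\<^sup>+x. ennreal (f x * exp (- k * g x)) \<partial>lborel)
    = (\<integral>\<^sup>+x. ennreal (f x * indicator {x. g x \<le> 1} x) \<partial>lborel) * ennreal c"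
    if [measurable]: "f \<in> borel_measurable borel" and "\<And>c x. c > 0 \<Longrightarrow> f (c *\<^sub>R x) = c ^ r * f x" for f
    unfolding c_def
    by (subst nn_integral_exp_neg_homogeneous[OF assms(1) that(1) g D that(2) nonneg k])
       (auto simp: ennreal_mult'' indicator_def intro!: nn_integral_cong arg_cong2[of _ _ _ _ "(*)"])
  show i: "integrable lborel (\<lambda>x. h x * exp (- k * g x))"
  proof (rule integrableI_bounded)
    have "(\<integral>\<^sup>+x. ennreal (\<bar>h x\<bar> * indicator {x. g x \<le> 1} x) \<partial>lborel) < \<infinity>"
      using int by (simp add: integrable_iff_bounded abs_mult)
    then have "(\<integral>\<^sup>+x. ennreal (\<bar>h x\<bar> * exp (- k * g x)) \<partial>lborel) < \<infinity>"
      by (subst eq) (auto simp: h abs_mult ennreal_mult_less_top)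
    then show "(\<integral>\<^sup>+x. ennreal (norm (h x * exp (- k * g x))) \<partial>lborel) < \<infinity>"
      by (simp add: abs_mult)
  qed auto
  have "(\<integral>x. h x * exp (- k * g x) \<partial>lborel)
      = (\<integral>x. h x * indicator {x. g x \<le> 1} x \<partial>lborel) * c"
    unfolding real_lebesgue_integral_def[OF i] real_lebesgue_integral_def[OF int]
    using eq[of h] eq[of "\<lambda>x. - h x"] h c
    by (simp add: enn2real_mult algebra_simps)
  then show "(\<integral>x. h x * exp (- k * g x) \<partial>lborel)
    = (\<integral>x. h x * indicator {x. g x \<le> 1} x \<partial>lborel)
      * (Gamma ((r + DIM('a)) / D + 1) / k powr ((r + DIM('a)) / D))"
    by (simp add: c_def)
qed

text \<open>Since {g \<le> t} has t^(n/D) times the volume of {g \<le> 1}, integrating over t in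
  [0,1] gives the integral of 1 - g over {g \<le> 1}. The resulting mean n/(D+n) later cancels the
  factor (2 s + n)/n in the moment formula for q^s.\<close>

lemma integral_homogeneous_sublevel:
  fixes g :: "'a::euclidean_space \<Rightarrow> real"
  assumes [measurable]: "g \<in> borel_measurable borel"
    and g: "\<And>c x. c > 0 \<Longrightarrow> g (c *\<^sub>R x) = c ^ D * g x" and D: "D > 0"
    and nonneg: "\<And>x. g x \<ge> 0"
    and fin: "emeasure lborel {x. g x \<le> 1} < \<infinity>"
  shows "(\<integral>x. g x * indicator {x. g x \<le> 1} x \<partial>lborel)
    = measure lborel {x. g x \<le> 1} * (DIM('a) / (D + DIM('a)))"
proof -
  define a where "a = real DIM('a) / D"
  have a: "a > 0" using D by (simp add: a_def)
  have U: "{x. g x \<le> 1} \<in> sets lborel" by measurable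
  have i1: "integrable lborel (\<lambda>x. indicator {x. g x \<le> 1} x :: real)"
    using fin U by (subst integrable_indicator_iff) auto
  have i2: "integrable lborel (\<lambda>x. g x * indicator {x. g x \<le> 1} x)"
    using i1 by (rule Bochner_Integration.integrable_bound)
      (use nonneg in \<open>auto split: split_indicator\<close>)
  have pow: "(\<integral>\<^sup>+t. indicator {0..1} t * indicator {0<..} t * ennreal (t powr a) \<partial>lborel) = ennreal (1 / (a + 1))"
  proof -
    have "(\<integral>\<^sup>+t. indicator {0..1} t * indicator {0<..} t * ennreal (t powr a) \<partial>lborel)
      = (\<integral>\<^sup>+t. ennreal (indicator {0..1} t * t powr a) \<partial>lborel)"
      using a by (intro nn_integral_cong) (auto split: split_indicator)
    also have "\<dots> = ennreal (1 / (a + 1))"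
    proof -
      have "((\<lambda>t. t powr a) has_integral (1 powr (a + 1) / (a + 1) - 0 powr (a + 1) / (a + 1))) {0..1}"
      \<comment> \<open>The antiderivative is continuous on the closed interval, while the
        derivative rule for \<open>powr\<close> is applied at positive t only.\<close>
      proof (intro fundamental_theorem_of_calculus_interior)
        show "continuous_on {0..1} (\<lambda>t. t powr (a + 1) / (a + 1))"
          using a by (intro continuous_intros continuous_on_powr') auto
        show "((\<lambda>t. t powr (a + 1) / (a + 1)) has_vector_derivative t powr a) (at t)"
          if "t \<in> {0<..<1}" for t
          using that a has_real_derivative_powr[of t "a + 1"]
          by (auto simp: has_real_derivative_iff_has_vector_derivative[symmetric]
              intro!: DERIV_cdivide[of _ "(a + 1) * t powr a", THEN DERIV_cong])
      qed auto
      then have "((\<lambda>t. t powr a) has_integral (1 / (a + 1))) {0..1}" using a by simp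
      from nn_integral_has_integral_lebesgue[OF _ this] show ?thesis by simp
    qed
    finally show ?thesis .
  qed
  \<comment> \<open>layer cake with weight 1 on the unit interval; it computes the integral of \<open>1 - g\<close>\<close>
  have len: "(\<integral>\<^sup>+t. indicator {0..1} t * indicator {t. 0 < t \<and> g x \<le> t} t \<partial>lborel)
      = ennreal ((1 - g x) * indicator {x. g x \<le> 1} x)" for x
  proof -
    have "(\<integral>\<^sup>+t. indicator {0..1} t * indicator {t. 0 < t \<and> g x \<le> t} t \<partial>lborel)
      = (\<integral>\<^sup>+t. indicator {g x..1} t \<partial>lborel)"
    proof (rule nn_integral_cong_AE)
      have "AE t in lborel. t \<noteq> (0::real)" by (rule AE_lborel_singleton)
      then show "AE t in lborel. indicator {0..1} t * indicator {t. 0 < t \<and> g x \<le> t} t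
        = (indicator {g x..1} t :: ennreal)"
        by eventually_elim (use nonneg[of x] in \<open>auto split: split_indicator\<close>)
    qed
    then show ?thesis by (auto split: split_indicator)
  qed
  have "(\<integral>\<^sup>+x. ennreal ((1 - g x) * indicator {x. g x \<le> 1} x) \<partial>lborel)
    = emeasure lborel {x. g x \<le> 1} * ennreal (1 / (a + 1))"
    using nn_integral_layer_cake_homogeneous[of g "\<lambda>_. 1" "indicator {0..1}" D 0] g D U
    by (simp add: len pow a_def[symmetric])
  also have "\<dots> = ennreal (measure lborel {x. g x \<le> 1} * (1 / (a + 1)))"
    using fin a by (simp add: emeasure_eq_ennreal_measure flip: ennreal_mult'')
  finally have "(\<integral>x. (1 - g x) * indicator {x. g x \<le> 1} x \<partial>lborel)
     = measure lborel {x. g x \<le> 1} * (1 / (a + 1))"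
    using a by (subst integral_eq_nn_integral) (auto split: split_indicator)
  moreover have "(\<integral>x. (1 - g x) * indicator {x. g x \<le> 1} x \<partial>lborel)
    = measure lborel {x. g x \<le> 1} - (\<integral>x. g x * indicator {x. g x \<le> 1} x \<partial>lborel)"
    using i1 i2 U by (simp add: left_diff_distrib)
  ultimately have "(\<integral>x. g x * indicator {x. g x \<le> 1} x \<partial>lborel)
    = measure lborel {x. g x \<le> 1} * (1 - 1 / (a + 1))"
    by (simp add: algebra_simps)
  also have "1 - 1 / (a + 1) = DIM('a) / (D + DIM('a))"
    using D a by (simp add: a_def field_simps)
  finally show ?thesis .
qed

subsection \<open>Monomials\<close>

text \<open>Induction on the set \<open>I\<close> of active variables: as a polynomial in one
  variable x_j the sum vanishes identically, so each coefficient vanishes, and each coefficient is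
  such a sum in the other variables. Exponents are functions on the whole index type, so injectivity
  of the restriction to \<open>I\<close> expresses that distinct members of \<open>A\<close> give
  distinct monomials in the active variables.\<close>

lemma monomials_lin_indep_on:
  fixes c :: "('n::finite \<Rightarrow> nat) \<Rightarrow> real"
  assumes "finite I" and "finite A" and "inj_on (\<lambda>\<alpha>. restrict \<alpha> I) A"
    and "\<And>x::'n \<Rightarrow> real. (\<Sum>\<alpha>\<in>A. c \<alpha> * (\<Prod>i\<in>I. x i ^ \<alpha> i)) = 0"
    and "\<alpha> \<in> A"
  shows "c \<alpha> = 0"
  using assms
proof (induction I arbitrary: A \<alpha> rule: finite_induct)
  case empty
  have "A = {\<alpha>}"
    using empty.prems(2,4) by (auto simp: inj_on_def restrict_def)
  then show ?case using empty.prems(3) by simp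
next
  case (insert j I)
  define N where "N = Max ((\<lambda>\<beta>. \<beta> j) ` A)"
  have N: "\<beta> j \<le> N" if "\<beta> \<in> A" for \<beta>
    using that insert.prems(1) by (simp add: N_def)
  define A' where "A' = (\<lambda>m. {\<beta>\<in>A. \<beta> j = m})"
  have slice: "(\<Sum>\<beta>\<in>A' m. c \<beta> * (\<Prod>i\<in>I. x i ^ \<beta> i)) = 0" if "m \<le> N" for m and x :: "'n \<Rightarrow> real"
  proof -
    define C where "C = (\<lambda>m. \<Sum>\<beta>\<in>A' m. c \<beta> * (\<Prod>i\<in>I. x i ^ \<beta> i))"
    have "(\<Sum>m\<le>N. C m * t ^ m) = 0" for t
    proof -
      have "(\<Sum>m\<le>N. C m * t ^ m)
        = (\<Sum>m\<le>N. \<Sum>\<beta>\<in>A' m. c \<beta> * (\<Prod>i\<in>insert j I. (x(j := t)) i ^ \<beta> i))"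
        unfolding C_def sum_distrib_right
      proof (intro sum.cong refl)
        fix m \<beta> assume "\<beta> \<in> A' m"
        moreover have "(\<Prod>i\<in>I. (x(j := t)) i ^ \<beta> i) = (\<Prod>i\<in>I. x i ^ \<beta> i)"
          using insert.hyps(2) by (intro prod.cong) auto
        ultimately show "c \<beta> * (\<Prod>i\<in>I. x i ^ \<beta> i) * t ^ m
          = c \<beta> * (\<Prod>i\<in>insert j I. (x(j := t)) i ^ \<beta> i)"
          using insert.hyps by (simp add: A'_def)
      qed
      also have "\<dots> = (\<Sum>\<beta>\<in>A. c \<beta> * (\<Prod>i\<in>insert j I. (x(j := t)) i ^ \<beta> i))"
        unfolding A'_def using insert.prems(1) N by (intro sum.group) auto
      finally show ?thesis using insert.prems(3) by simp
    qed
    \<comment> \<open>A univariate polynomial vanishing at every t has zero coefficients;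
      \<open>N\<close> bounds its degree.\<close>
    then have "\<forall>m\<le>N. C m = 0" by (subst polyfun_eq_0[symmetric]) auto
    then show ?thesis using that by (simp add: C_def)
  qed
  show ?case
  proof (rule insert.IH)
    show "finite (A' (\<alpha> j))" "\<alpha> \<in> A' (\<alpha> j)" using insert.prems by (auto simp: A'_def)
    show "inj_on (\<lambda>\<beta>. restrict \<beta> I) (A' (\<alpha> j))"
    proof (rule inj_onI)
      fix \<beta> \<gamma> assume *: "\<beta> \<in> A' (\<alpha> j)" "\<gamma> \<in> A' (\<alpha> j)" "restrict \<beta> I = restrict \<gamma> I"
      \<comment> \<open>Members of one slice share their exponent at j, so agreement on
        \<open>I\<close> extends to \<open>insert j I\<close>.\<close>
      then have "restrict \<beta> (insert j I) = restrict \<gamma> (insert j I)"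
        by (auto simp: A'_def fun_eq_iff restrict_def split: if_splits)
      then show "\<beta> = \<gamma>" by (rule inj_onD[OF insert.prems(2)]) (use * in \<open>auto simp: A'_def\<close>)
    qed
    show "(\<Sum>\<beta>\<in>A' (\<alpha> j). c \<beta> * (\<Prod>i\<in>I. x i ^ \<beta> i)) = 0" for x
      by (rule slice) (use N insert.prems(4) in auto)
  qed
qed

lemma monomial_vec_lin_indep:
  fixes e :: "'m::finite \<Rightarrow> 'n::finite \<Rightarrow> nat" and c :: "real ^ 'm"
  assumes "inj e" and zero: "\<And>x. c \<bullet> monomial_vec e x = 0"
  shows "c = 0"
proof -
  have "c $ a = 0" for a
  proof -
    have "(c $ inv e (e a)) = 0"
    proof (rule monomials_lin_indep_on[of UNIV "range e" "\<lambda>\<alpha>. c $ inv e \<alpha>" "e a"])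
      fix x :: "'n \<Rightarrow> real"
      have "(\<Sum>\<alpha>\<in>range e. (c $ inv e \<alpha>) * (\<Prod>i\<in>UNIV. x i ^ \<alpha> i))
        = c \<bullet> monomial_vec e (\<chi> i. x i)"
        using \<open>inj e\<close> by (subst sum.reindex) (auto simp: inner_vec_def monomial_vec_def)
      then show "(\<Sum>\<alpha>\<in>range e. (c $ inv e \<alpha>) * (\<Prod>i\<in>UNIV. x i ^ \<alpha> i)) = 0"
        using zero by simp
    qed (auto simp: restrict_def)
    then show ?thesis using \<open>inj e\<close> by simp
  qed
  then show ?thesis by (simp add: vec_eq_iff)
qed

text \<open>The coefficients are indexed by exponents and not by an enumeration \<open>e\<close>,
  because an enumeration is tied to one degree and the substitution argument below is an induction
  on the degree.\<close>

definition homogeneous_polys :: "nat \<Rightarrow> (real ^ 'n::finite \<Rightarrow> real) set" where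
  "homogeneous_polys k =
     {f. \<exists>c. \<forall>x. f x = (\<Sum>\<alpha>\<in>multi_exponents k. c \<alpha> * (\<Prod>i\<in>UNIV. (x $ i) ^ \<alpha> i))}"

lemma homogeneous_polys_add:
  "f \<in> homogeneous_polys k \<Longrightarrow> g \<in> homogeneous_polys k \<Longrightarrow> (\<lambda>x. f x + g x) \<in> homogeneous_polys k"
proof -
  assume "f \<in> homogeneous_polys k" "g \<in> homogeneous_polys k"
  then obtain c c' where "\<And>x. f x = (\<Sum>\<alpha>\<in>multi_exponents k. c \<alpha> * (\<Prod>i\<in>UNIV. (x $ i) ^ \<alpha> i))"
    "\<And>x. g x = (\<Sum>\<alpha>\<in>multi_exponents k. c' \<alpha> * (\<Prod>i\<in>UNIV. (x $ i) ^ \<alpha> i))"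
    unfolding homogeneous_polys_def by auto
  then show ?thesis
    unfolding homogeneous_polys_def
    by (auto intro!: exI[of _ "\<lambda>\<alpha>. c \<alpha> + c' \<alpha>"] simp: algebra_simps sum.distrib)
qed

lemma homogeneous_polys_cmult:
  "f \<in> homogeneous_polys k \<Longrightarrow> (\<lambda>x. r * f x) \<in> homogeneous_polys k"
proof -
  assume "f \<in> homogeneous_polys k"
  then obtain c where "\<And>x. f x = (\<Sum>\<alpha>\<in>multi_exponents k. c \<alpha> * (\<Prod>i\<in>UNIV. (x $ i) ^ \<alpha> i))"
    unfolding homogeneous_polys_def by auto
  then show ?thesis
    unfolding homogeneous_polys_def
    by (auto intro!: exI[of _ "\<lambda>\<alpha>. r * c \<alpha>"] simp: sum_distrib_left mult.assoc)
qed

lemma homogeneous_polys_monomial: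
  "\<beta> \<in> multi_exponents k \<Longrightarrow> (\<lambda>x. \<Prod>i\<in>UNIV. (x $ i) ^ \<beta> i) \<in> homogeneous_polys k"
  unfolding homogeneous_polys_def
  by (auto intro!: exI[of _ "\<lambda>\<alpha>. if \<alpha> = \<beta> then 1 else 0"]
      simp: finite_multi_exponents sum.delta' if_distrib[of "\<lambda>z. z * _"] cong: if_cong)

lemma homogeneous_polys_sum:
  assumes "finite A" "A \<noteq> {}" "\<And>a. a \<in> A \<Longrightarrow> f a \<in> homogeneous_polys k"
  shows "(\<lambda>x. \<Sum>a\<in>A. f a x) \<in> homogeneous_polys k"
  using assms
proof (induction A rule: finite_ne_induct)
  case (insert a A)
  then show ?case using homogeneous_polys_add[of "f a" k "\<lambda>x. \<Sum>a\<in>A. f a x"] by simp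
qed simp

lemma multi_exponents_nonempty: "multi_exponents k \<noteq> ({} :: ('n::finite \<Rightarrow> nat) set)"
  using card_multi_exponents[of k, where 'n = 'n] by auto

lemma homogeneous_polys_times_coord:
  fixes f :: "real ^ 'n::finite \<Rightarrow> real"
  assumes "f \<in> homogeneous_polys k"
  shows "(\<lambda>x. x $ j * f x) \<in> homogeneous_polys (Suc k)"
proof -
  obtain c where c: "\<And>x. f x = (\<Sum>\<alpha>\<in>multi_exponents k. c \<alpha> * (\<Prod>i\<in>UNIV. (x $ i) ^ \<alpha> i))"
    using assms unfolding homogeneous_polys_def by auto
  have "x $ j * (\<Prod>i\<in>UNIV. (x $ i) ^ \<alpha> i) = (\<Prod>i\<in>UNIV. (x $ i) ^ (\<alpha>(j := Suc (\<alpha> j))) i)"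
    for \<alpha> and x :: "real ^ 'n"
    by (simp add: prod.remove[of UNIV j] mult.assoc)
  then have "(\<lambda>x. x $ j * f x)
    = (\<lambda>x. \<Sum>\<alpha>\<in>multi_exponents k. c \<alpha> * (\<Prod>i\<in>UNIV. (x $ i) ^ (\<alpha>(j := Suc (\<alpha> j))) i))"
    by (simp add: c sum_distrib_left mult.left_commute)
  also have "\<dots> \<in> homogeneous_polys (Suc k)"
  proof (intro homogeneous_polys_sum homogeneous_polys_cmult homogeneous_polys_monomial
      finite_multi_exponents multi_exponents_nonempty)
    fix \<alpha> :: "'n \<Rightarrow> nat" assume "\<alpha> \<in> multi_exponents k"
    then show "\<alpha>(j := Suc (\<alpha> j)) \<in> multi_exponents (Suc k)"
      by (simp add: multi_exponents_def sum.remove[of UNIV j])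
  qed
  finally show ?thesis .
qed

lemma homogeneous_polys_times_linear:
  fixes f :: "real ^ 'n::finite \<Rightarrow> real"
  assumes "f \<in> homogeneous_polys k"
  shows "(\<lambda>x. (v \<bullet> x) * f x) \<in> homogeneous_polys (Suc k)"
proof -
  have "(\<lambda>x. (v \<bullet> x) * f x) = (\<lambda>x. \<Sum>j\<in>UNIV. v $ j * (x $ j * f x))"
    by (simp add: inner_vec_def sum_distrib_right mult.assoc)
  also have "\<dots> \<in> homogeneous_polys (Suc k)"
    by (intro homogeneous_polys_sum homogeneous_polys_cmult homogeneous_polys_times_coord assms) auto
  finally show ?thesis .
qed

text \<open>One factor (A x)_j is split off at a time. It is the linear form given by row j of
  \<open>A\<close>, and multiplying by a linear form raises the degree by one.\<close>

lemma monomial_linear_substitution: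
  fixes A :: "real ^ 'n::finite ^ 'n"
  assumes "\<alpha> \<in> multi_exponents k"
  shows "(\<lambda>x. \<Prod>i\<in>UNIV. ((A *v x) $ i) ^ \<alpha> i) \<in> homogeneous_polys k"
  using assms
proof (induction k arbitrary: \<alpha>)
  case 0
  then have "\<alpha> = (\<lambda>_. 0)" by (auto simp: multi_exponents_def)
  with homogeneous_polys_monomial[OF 0] show ?case by simp
next
  case (Suc k)
  then obtain j where j: "\<alpha> j > 0"
    by (force simp: multi_exponents_def intro: ccontr)
  define \<beta> where "\<beta> = \<alpha>(j := \<alpha> j - 1)"
  have \<alpha>: "\<alpha> = \<beta>(j := Suc (\<beta> j))" using j by (auto simp: \<beta>_def)
  have "\<beta> \<in> multi_exponents k"
    using Suc.prems by (simp add: multi_exponents_def sum.remove[of UNIV j] \<alpha>)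
  from homogeneous_polys_times_linear[OF Suc.IH[OF this], of "row j A"] show ?case
    by (simp add: \<alpha> prod.remove[of UNIV j] mult.assoc matrix_vector_mul_component row_def
        vec_nth_inverse)
qed

text \<open>\<open>S\<close> represents the k-th symmetric power of \<open>A\<close> in monomial
  coordinates: row a holds the coefficients of the monomial with exponent \<open>e a\<close>
  evaluated at A x.\<close>

lemma monomial_vec_linear_substitution:
  fixes A :: "real ^ 'n::finite ^ 'n" and e :: "'m::finite \<Rightarrow> 'n \<Rightarrow> nat"
  assumes "enumerates_exponents e k"
  obtains S where "\<And>x. monomial_vec e (A *v x) = S *v monomial_vec e x"
proof -
  have bij: "bij_betw e UNIV (multi_exponents k)"
    using assms by (simp add: enumerates_exponents_def)
  have "\<exists>v. \<forall>x. monomial_vec e (A *v x) $ a = v \<bullet> monomial_vec e x" for a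
  proof -
    have "e a \<in> multi_exponents k" using bij by (auto simp: bij_betw_def)
    from monomial_linear_substitution[OF this, of A] obtain c where
      c: "\<And>x. (\<Prod>i\<in>UNIV. ((A *v x) $ i) ^ e a i)
        = (\<Sum>\<alpha>\<in>multi_exponents k. c \<alpha> * (\<Prod>i\<in>UNIV. (x $ i) ^ \<alpha> i))"
      unfolding homogeneous_polys_def by auto
    show ?thesis
      by (intro exI[of _ "\<chi> b. c (e b)"])
        (simp add: monomial_vec_def c inner_vec_def flip: sum.reindex_bij_betw[OF bij])
  qed
  then obtain v where v: "\<And>a x. monomial_vec e (A *v x) $ a = v a \<bullet> monomial_vec e x"
    by metis
  have "monomial_vec e (A *v x) = (\<chi> a. v a) *v monomial_vec e x" for x
    by (simp add: vec_eq_iff v matrix_vector_mul_component)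
  then show thesis by (rule that)
qed

subsection \<open>Linear maps and Lebesgue measure\<close>

lemma nn_integral_lborel_translate:
  fixes f :: "'a::euclidean_space \<Rightarrow> ennreal"
  assumes [measurable]: "f \<in> borel_measurable borel"
  shows "(\<integral>\<^sup>+x. f (a + x) \<partial>lborel) = (\<integral>\<^sup>+x. f x \<partial>lborel)"
proof -
  have "(\<integral>\<^sup>+x. f x \<partial>lborel) = (\<integral>\<^sup>+x. f x \<partial>distr lborel borel ((+) a))"
    by (simp add: lborel_distr_plus)
  then show ?thesis by (simp add: nn_integral_distr)
qed

lemma nn_integral_lborel_reflect:
  fixes f :: "'a::euclidean_space \<Rightarrow> ennreal"
  assumes [measurable]: "f \<in> borel_measurable borel"
  shows "(\<integral>\<^sup>+x. f (a - x) \<partial>lborel) = (\<integral>\<^sup>+x. f x \<partial>lborel)"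
proof -
  have L: "lborel = density (distr lborel borel (\<lambda>x. a + (-1) *\<^sub>R x)) (\<lambda>_. 1)"
    using lborel_affine[of "-1" a] by simp
  have "(\<integral>\<^sup>+x. f x \<partial>lborel)
    = (\<integral>\<^sup>+x. f x \<partial>density (distr lborel borel (\<lambda>x. a + (-1) *\<^sub>R x)) (\<lambda>_. 1))"
    by (subst L) (rule refl)
  then show ?thesis by (simp add: nn_integral_density nn_integral_distr)
qed

text \<open>Uniqueness of translation invariant measures by Tonelli: shift \<open>y\<close> by \<open>f x\<close>, swap, and shift back.
  The theorem \<open>measure_linear_image\<close> of the library needs a well-ordered index type.\<close>

lemma emeasure_linear_vimage_proportional:
  fixes f :: "'a::euclidean_space \<Rightarrow> 'a"
  assumes f: "linear f" "surj f" and [measurable]: "X \<in> sets borel" "Y \<in> sets borel"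
  shows "emeasure lborel (f -` X) * emeasure lborel Y = emeasure lborel (f -` Y) * emeasure lborel X"
proof -
  have [measurable]: "f \<in> borel_measurable borel"
    using f by (intro borel_measurable_continuous_onI) (simp add: linear_continuous_on linear_linear)
  have vim: "emeasure lborel (f -` Z) = (\<integral>\<^sup>+x. indicator Z (f x) \<partial>lborel)" if "Z \<in> sets borel" for Z
  proof -
    have "f -` Z \<in> sets lborel" using measurable_sets[of f borel borel Z] that by simp
    then show ?thesis
      by (simp add: nn_integral_indicator[symmetric] indicator_vimage del: nn_integral_indicator)
  qed
  \<comment> \<open>A right inverse of \<open>f\<close> is what the shift back requires: translating
    x by - g y turns f x into f x - y, which moves y from the argument of \<open>Y\<close> to that
    of \<open>X\<close>.\<close>
  define g where "g = inv f"
  have g: "f (g y) = y" for y using f by (simp add: g_def surj_f_inv_f)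
  have "emeasure lborel (f -` X) * emeasure lborel Y
    = (\<integral>\<^sup>+x. indicator X (f x) * (\<integral>\<^sup>+y. indicator Y y \<partial>lborel) \<partial>lborel)"
    by (simp add: vim nn_integral_multc)
  also have "\<dots> = (\<integral>\<^sup>+x. indicator X (f x) * (\<integral>\<^sup>+y. indicator Y (f x + y) \<partial>lborel) \<partial>lborel)"
    by (subst nn_integral_lborel_translate) simp_all
  also have "\<dots> = (\<integral>\<^sup>+x. (\<integral>\<^sup>+y. indicator X (f x) * indicator Y (f x + y) \<partial>lborel) \<partial>lborel)"
    by (intro nn_integral_cong nn_integral_cmult[symmetric]) auto
  also have "\<dots> = (\<integral>\<^sup>+y. (\<integral>\<^sup>+x. indicator X (f x) * indicator Y (f x + y) \<partial>lborel) \<partial>lborel)"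
    by (rule lborel_pair.Fubini') measurable
  also have "\<dots> = (\<integral>\<^sup>+y. (\<integral>\<^sup>+x. indicator X (f x - y) * indicator Y (f x) \<partial>lborel) \<partial>lborel)"
  proof (rule nn_integral_cong)
    fix y
    have "(\<integral>\<^sup>+x. indicator X (f x) * indicator Y (f x + y) \<partial>lborel)
      = (\<integral>\<^sup>+x. indicator X (f (- g y + x)) * indicator Y (f (- g y + x) + y) \<partial>lborel)"
      by (rule nn_integral_lborel_translate[symmetric]) measurable
    then show "(\<integral>\<^sup>+x. indicator X (f x) * indicator Y (f x + y) \<partial>lborel)
      = (\<integral>\<^sup>+x. indicator X (f x - y) * (indicator Y (f x) :: ennreal) \<partial>lborel)"
      using f by (simp add: linear_diff g)
  qed
  also have "\<dots> = (\<integral>\<^sup>+x. (\<integral>\<^sup>+y. indicator X (f x - y) * indicator Y (f x) \<partial>lborel) \<partial>lborel)"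
    by (rule lborel_pair.Fubini') measurable
  also have "\<dots> = (\<integral>\<^sup>+x. (\<integral>\<^sup>+y. indicator X (f x - y) \<partial>lborel) * indicator Y (f x) \<partial>lborel)"
    by (intro nn_integral_cong nn_integral_multc) auto
  also have "\<dots> = (\<integral>\<^sup>+x. emeasure lborel X * indicator Y (f x) \<partial>lborel)"
    by (subst nn_integral_lborel_reflect) simp_all
  also have "\<dots> = emeasure lborel (f -` Y) * emeasure lborel X"
    by (simp add: vim nn_integral_cmult mult.commute)
  finally show ?thesis .
qed

text \<open>Proportionality is normalized at the open unit cube, so the factor is the volume of the
  cube's preimage. That preimage is bounded, hence of finite volume, and open and nonempty, hence of
  positive volume.\<close>

lemma emeasure_linear_vimage_scale:
  fixes f :: "'a::euclidean_space \<Rightarrow> 'a"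
  assumes f: "linear f" "surj f"
  obtains c where "c > (0::real)"
    "\<And>X. X \<in> sets borel \<Longrightarrow> emeasure lborel (f -` X) = ennreal c * emeasure lborel X"
proof -
  define Y :: "'a set" where "Y = box 0 One"
  have Y: "emeasure lborel Y = 1"
    unfolding Y_def by (subst emeasure_lborel_box) auto
  have "inj f" using f by (simp add: linear_surjective_imp_injective)
  then have img: "f -` Y = inv f ` Y"
    using f by (auto simp: image_iff surj_f_inv_f) (metis inv_f_f)
  have "linear (inv f)"
    using f \<open>inj f\<close> by (metis bij_def inj_linear_imp_inv_linear)
  then have "bounded (f -` Y)"
    unfolding img by (intro bounded_linear_image) (auto simp: Y_def linear_linear)
  then have fin: "emeasure lborel (f -` Y) < \<infinity>" by (rule emeasure_bounded_finite)
  have "open (f -` Y)"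
    using f by (intro open_vimage) (auto simp: Y_def linear_continuous_on linear_linear)
  moreover have "f -` Y \<noteq> {}"
  proof -
    have "One /\<^sub>R 2 \<in> Y" by (auto simp: Y_def mem_box)
    then show ?thesis using f by (metis empty_iff surj_f_inv_f vimageI)
  qed
  ultimately have "f -` Y \<notin> null_sets lborel"
    using open_not_negligible[of "f -` Y"] by (auto simp: negligible_iff_null_sets null_sets_completionI)
  with \<open>open (f -` Y)\<close> have pos: "emeasure lborel (f -` Y) \<noteq> 0"
    by (simp add: null_sets_def)
  show thesis
  proof (rule that)
    show "measure lborel (f -` Y) > 0"
      using fin pos by (simp add: measure_def enn2real_positive_iff less_top[symmetric] zero_less_iff_neq_zero)
    show "emeasure lborel (f -` X) = ennreal (measure lborel (f -` Y)) * emeasure lborel X"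
      if "X \<in> sets borel" for X
      using emeasure_linear_vimage_proportional[OF f that, of Y] fin
      by (simp add: Y emeasure_eq_ennreal_measure) (simp add: Y_def)
  qed
qed

text \<open>Taking the preimage of the unit cube twice returns the cube, so the volume factor has
  square 1 and, being positive, equals 1.\<close>

lemma emeasure_involution_vimage:
  fixes f :: "'a::euclidean_space \<Rightarrow> 'a"
  assumes "linear f" and ff: "\<And>x. f (f x) = x" and X: "X \<in> sets borel"
  shows "emeasure lborel (f -` X) = emeasure lborel X"
proof -
  have "surj f" using ff by (metis surjI)
  then obtain c where c: "c > 0"
    "\<And>X. X \<in> sets borel \<Longrightarrow> emeasure lborel (f -` X) = ennreal c * emeasure lborel X"
    using emeasure_linear_vimage_scale[OF \<open>linear f\<close>] by blast
  define Y :: "'a set" where "Y = box 0 One"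
  have Y: "emeasure lborel Y = 1"
    unfolding Y_def by (subst emeasure_lborel_box) auto
  have "open (f -` Y)"
    using \<open>linear f\<close> by (intro open_vimage) (auto simp: Y_def linear_continuous_on linear_linear)
  then have "emeasure lborel (f -` (f -` Y)) = ennreal c * (ennreal c * emeasure lborel Y)"
    by (simp add: c(2)) (simp add: c(2) Y_def)
  moreover have "f -` (f -` Y) = Y" using ff by auto
  ultimately have "ennreal (c * c) = 1" using c(1) by (simp add: Y ennreal_mult)
  then have "c * c = 1" using c(1) by simp
  then have "c = 1" using c(1) by (simp add: square_eq_1_iff)
  then show ?thesis using c(2)[OF X] by simp
qed

section \<open>The determinant as volume factor\<close>

lemma borel_measurable_matrix_vector_mult [measurable]:
  fixes A :: "real ^ 'n::finite ^ 'm::finite"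
  shows "(*v) A \<in> borel_measurable borel"
  by (intro borel_measurable_continuous_onI) (auto intro: linear_continuous_on)

lemma vimage_matrix_vector_mult_borel [intro]:
  fixes A :: "real ^ 'n::finite ^ 'm::finite"
  shows "X \<in> sets borel \<Longrightarrow> (*v) A -` X \<in> sets borel"
  using measurable_sets[OF borel_measurable_matrix_vector_mult, of X A] by simp

lemma emeasure_diagonal_vimage:
  fixes A :: "real ^ 'n::finite ^ 'n"
  assumes diag: "\<And>i j. i \<noteq> j \<Longrightarrow> A $ i $ j = 0" and "det A \<noteq> 0" and X: "X \<in> sets borel"
  shows "ennreal \<bar>det A\<bar> * emeasure lborel ((*v) A -` X) = emeasure lborel X"
proof -
  have det: "det A = (\<Prod>i\<in>UNIV. A $ i $ i)" by (rule det_diagonal) (rule diag)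
  then have nz: "A $ i $ i \<noteq> 0" for i using \<open>det A \<noteq> 0\<close> by auto
  \<comment> \<open>The affine substitution rule takes one scale factor per basis vector; at
    \<open>axis i 1\<close> this expression is the i-th diagonal entry.\<close>
  define c :: "real ^ 'n \<Rightarrow> real" where "c = (\<lambda>b. b \<bullet> (A *v b))"
  have comp: "(A *v x) $ i = A $ i $ i * x $ i" for x i
    using diag by (simp add: matrix_vector_mult_def sum.remove[of UNIV i])
  have Basis: "(Basis :: (real ^ 'n) set) = range (\<lambda>i. axis i 1)"
    by (auto simp: Basis_vec_def)
  have caxis: "c (axis i 1) = A $ i $ i" for i
    by (simp add: c_def inner_axis' comp)
  have T: "A *v x = (0 :: real ^ 'n) + (\<Sum>j\<in>Basis. (c j * (x \<bullet> j)) *\<^sub>R j)" for x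
  proof -
    have "A *v x = (\<Sum>j\<in>Basis. ((A *v x) \<bullet> j) *\<^sub>R j)" by (simp add: euclidean_representation)
    also have "\<dots> = (\<Sum>j\<in>Basis. (c j * (x \<bullet> j)) *\<^sub>R j)"
      by (intro sum.cong refl arg_cong2[where f = scaleR]) (auto simp: Basis caxis inner_axis comp)
    finally show ?thesis by simp
  qed
  have "(\<Prod>j\<in>Basis. \<bar>c j\<bar>) = \<bar>det A\<bar>"
    unfolding Basis by (subst prod.reindex) (auto simp: inj_on_def axis_eq_axis caxis det abs_prod)
  moreover have "lborel = density (distr lborel borel (\<lambda>x. (0 :: real ^ 'n) + (\<Sum>j\<in>Basis. (c j * (x \<bullet> j)) *\<^sub>R j)))
      (\<lambda>_. (\<Prod>j\<in>Basis. \<bar>c j\<bar>))"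
    by (rule lborel_affine_euclidean) (auto simp: Basis caxis nz)
  ultimately have "lborel = density (distr lborel borel ((*v) A)) (\<lambda>_. \<bar>det A\<bar>)"
    unfolding T[symmetric] by simp
  then have "emeasure lborel X = emeasure (density (distr lborel borel ((*v) A)) (\<lambda>_. \<bar>det A\<bar>)) X"
    by simp
  also have "\<dots> = ennreal \<bar>det A\<bar> * emeasure lborel ((*v) A -` X)"
    using X by (subst emeasure_density) (simp_all add: nn_integral_cmult emeasure_distr)
  finally show ?thesis by simp
qed

text \<open>The absolute determinant and the volume factor are both multiplicative, so elementary
  matrices suffice. A zero row contradicts the nonzero determinant, diagonal matrices scale
  coordinates, swaps are involutions, and shears are handled by a conjugation.\<close>

theorem emeasure_matrix_vimage:
  fixes A :: "real ^ 'n::finite ^ 'n"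
  assumes "det A \<noteq> 0" "X \<in> sets borel"
  shows "ennreal \<bar>det A\<bar> * emeasure lborel ((*v) A -` X) = emeasure lborel X"
  using assms
proof (induction A arbitrary: X rule: induct_matrix_elementary_alt)
  case (1 A B X)
  have "(*v) (A ** B) -` X = (*v) B -` ((*v) A -` X)"
    by (auto simp: matrix_vector_mul_assoc)
  moreover have "det A \<noteq> 0" "det B \<noteq> 0" using 1 by (auto simp: det_mul)
  ultimately show ?case
    using 1(1)[of X] 1(2)[of "(*v) A -` X"] 1(4) vimage_matrix_vector_mult_borel[of X A]
    by (simp add: det_mul abs_mult ennreal_mult mult.assoc)
next
  case (2 A i X)
  then show ?case by (simp add: det_zero_row)
next
  case (3 A X)
  then show ?case by (intro emeasure_diagonal_vimage)
next
  case (4 m n X)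
  define R :: "real ^ 'n ^ 'n" where "R = (\<chi> i j. mat 1 $ i $ Transposition.transpose m n j)"
  have "i = Transposition.transpose m n j \<longleftrightarrow> j = Transposition.transpose m n i" for i j
    by (metis transpose_involutory)
  then have "R $ i $ j = (if j = Transposition.transpose m n i then 1 else 0)" for i j
    unfolding R_def mat_def vec_lambda_beta by metis
  then have "(\<Sum>j\<in>UNIV. R $ i $ j * x $ j)
    = (\<Sum>j\<in>UNIV. if j = Transposition.transpose m n i then x $ j else 0)" for i x
    by (intro sum.cong) auto
  then have "R *v x = (\<chi> i. x $ Transposition.transpose m n i)" for x
    by (simp add: vec_eq_iff matrix_vector_mult_def)
  then have RR: "R *v (R *v x) = x" for x by simp
  then have "R ** R = mat 1" by (simp add: matrix_eq flip: matrix_vector_mul_assoc)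
  then have "(det R)\<^sup>2 = 1" using det_mul[of R R] by (simp add: power2_eq_square)
  then have "\<bar>det R\<bar> = 1" by (simp add: abs_square_eq_1)
  then show ?case
    using emeasure_involution_vimage[of "(*v) R" X] RR 4 by (simp add: R_def[symmetric])
next
  case (5 m n X)
  define T :: "real ^ 'n ^ 'n" where "T = (\<chi> i j. of_bool (i = m \<and> j = n \<or> i = j))"
  \<comment> \<open>Doubling coordinate m after adding x_n to it amounts to doubling first and then
    adding x_n twice.\<close>
  define D :: "real ^ 'n ^ 'n" where "D = (\<chi> i j. if i = j then if i = m then 2 else 1 else 0)"
  have Tx: "(T *v x) $ i = (if i = m then x $ m + x $ n else x $ i)" for x i
  proof -
    have "(\<Sum>j\<in>UNIV. T $ i $ j * x $ j)
      = (\<Sum>j\<in>UNIV. (if j = i then x $ j else 0) + (if j = n then if i = m then x $ n else 0 else 0))"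
      using \<open>m \<noteq> n\<close> by (intro sum.cong) (auto simp: T_def)
    then show ?thesis by (simp add: matrix_vector_mult_def sum.distrib)
  qed
  have Dx: "(D *v x) $ i = (if i = m then 2 * x $ m else x $ i)" for x i
  proof -
    have "(\<Sum>j\<in>UNIV. D $ i $ j * x $ j) = (\<Sum>j\<in>UNIV. if j = i then (if i = m then 2 else 1) * x $ j else 0)"
      by (intro sum.cong) (auto simp: D_def)
    then show ?thesis by (simp add: matrix_vector_mult_def)
  qed
  \<comment> \<open>the shear \<open>T\<close> is conjugate to its own square, so its scaling factor is 1\<close>
  have comm: "D *v (T *v x) = T *v (T *v (D *v x))" for x
    using \<open>m \<noteq> n\<close> by (simp add: vec_eq_iff Tx Dx)
  then have "D ** T = T ** T ** D" by (simp add: matrix_eq flip: matrix_vector_mul_assoc)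
  then have "det D * det T = det T * det T * det D" by (metis det_mul)
  moreover have detD: "det D \<noteq> 0" by (subst det_diagonal) (auto simp: D_def)
  moreover have detT: "det T \<noteq> 0" using 5 by (simp add: T_def)
  ultimately have "det T = 1" by simp
  have surj: "surj ((*v) A)" if "det A \<noteq> 0" for A :: "real ^ 'n ^ 'n"
    using that by (metis invertible_det_nz invertible_def matrix_right_invertible_surjective)
  obtain c where c: "c > 0"
    "\<And>X. X \<in> sets borel \<Longrightarrow> emeasure lborel ((*v) T -` X) = ennreal c * emeasure lborel X"
    using emeasure_linear_vimage_scale[of "(*v) T"] surj[OF detT] by auto
  obtain d where d: "d > 0"
    "\<And>X. X \<in> sets borel \<Longrightarrow> emeasure lborel ((*v) D -` X) = ennreal d * emeasure lborel X"
    using emeasure_linear_vimage_scale[of "(*v) D"] surj[OF detD] by auto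
  define Y :: "(real ^ 'n) set" where "Y = box 0 One"
  have Y: "emeasure lborel Y = 1" "Y \<in> sets borel"
    unfolding Y_def by (subst emeasure_lborel_box) auto
  \<comment> \<open>The preimage of the unit cube under both sides of \<open>comm\<close> is
    measured; comparing the volumes gives c d = d c^2.\<close>
  have "emeasure lborel ((*v) T -` ((*v) D -` Y)) = ennreal (c * d)"
    using Y c(1) d(1) by (subst c(2)) (auto simp: d(2) ennreal_mult)
  moreover have "emeasure lborel ((*v) D -` ((*v) T -` ((*v) T -` Y))) = ennreal (d * c * c)"
    using Y c(1) d(1) by (subst d(2), blast, subst c(2), blast, subst c(2), blast)
      (auto simp: ennreal_mult mult.assoc)
  moreover have "(*v) T -` ((*v) D -` Y) = (*v) D -` ((*v) T -` ((*v) T -` Y))"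
    by (auto simp: comm)
  ultimately have "c * d = d * c * c" using c d by simp
  then have "c = 1" using c(1) d(1) by simp
  then show ?case using c(2)[of X] 5(3) \<open>det T = 1\<close> unfolding T_def[symmetric] by simp
qed

subsection \<open>Positive definite quadratic forms\<close>

lemma symmetric_mat_inner: "symmetric_mat A \<Longrightarrow> x \<bullet> (A *v y) = y \<bullet> (A *v x)"
  by (metis dot_lmul_matrix inner_commute symmetric_mat_def transpose_matrix_vector)

lemma inner_transpose_mult:
  fixes B :: "real ^ 'n::finite ^ 'm::finite"
  shows "x \<bullet> (transpose B *v y) = (B *v x) \<bullet> y"
  by (metis dot_lmul_matrix inner_commute vector_transpose_matrix)

text \<open>Orthonormalization for the inner product defined by \<open>Q\<close>: the columns of
  \<open>B\<close> form a Q-orthonormal basis, built one vector at a time.\<close>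

lemma pos_def_orthonormal_basis:
  fixes Q :: "real ^ 'n::finite ^ 'n"
  assumes Q: "pos_def_mat Q"
  obtains B :: "real ^ 'n ^ 'n" where "transpose B ** Q ** B = mat 1"
proof -
  have sym: "symmetric_mat Q" and pos: "\<And>x. x \<noteq> 0 \<Longrightarrow> x \<bullet> (Q *v x) > 0"
    using Q by (auto simp: pos_def_mat_def)
  define orth where "orth = (\<lambda>S. \<forall>x\<in>S. \<forall>y\<in>S. x \<bullet> (Q *v y) = (if x = y then 1 else 0))"
  have "k \<le> CARD('n) \<Longrightarrow> \<exists>S. finite S \<and> card S = k \<and> orth S" for k
  proof (induction k)
    case 0
    show ?case by (intro exI[of _ "{}"]) (auto simp: orth_def)
  next
    case (Suc k)
    then obtain S where S: "finite S" "card S = k" "orth S" by auto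
    \<comment> \<open>With fewer than n vectors, the vectors Q y span a proper subspace. A nonzero
      vector orthogonal to it in the usual sense is Q-orthogonal to all of \<open>S\<close>.\<close>
    have "dim ((*v) Q ` S) \<le> k"
      using S card_image_le[of S "(*v) Q"] by (intro order.trans[OF dim_le_card']) auto
    then have "dim ((*v) Q ` S) < DIM(real ^ 'n)" using Suc.prems by simp
    from orthogonal_to_subspace_exists[OF this] obtain x where x: "x \<noteq> 0"
      and xS: "\<And>y. y \<in> S \<Longrightarrow> x \<bullet> (Q *v y) = 0"
      by (metis imageI orthogonal_def span_base)
    define z where "z = x /\<^sub>R sqrt (x \<bullet> (Q *v x))"
    have z: "z \<bullet> (Q *v z) = 1"
      using pos[OF x] by (simp add: z_def matrix_vector_mult_scaleR field_simps flip: power2_eq_square)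
    have zS: "z \<bullet> (Q *v y) = 0" if "y \<in> S" for y
      using xS[OF that] by (simp add: z_def)
    have zS': "y \<bullet> (Q *v z) = 0" if "y \<in> S" for y
      by (subst symmetric_mat_inner[OF sym]) (rule zS[OF that])
    have "z \<notin> S" using z zS by auto
    moreover have "orth (insert z S)"
      using S(3) z zS zS' \<open>z \<notin> S\<close> by (auto simp: orth_def)
    ultimately show ?case
      using S by (intro exI[of _ "insert z S"]) auto
  qed
  then obtain S where S: "finite S" "card S = CARD('n)" "orth S" by blast
  then obtain f :: "'n \<Rightarrow> real ^ 'n" where f: "bij_betw f UNIV S"
    by (metis finite_class.finite_UNIV finite_same_card_bij)
  define B where "B = (\<chi> i j. f j $ i)"
  have col: "B *v axis j 1 = f j" for j
    by (simp add: matrix_vector_mult_basis column_def B_def)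
  have "(transpose B ** Q ** B) $ i $ j = f i \<bullet> (Q *v f j)" for i j
  proof -
    have "(transpose B ** Q ** B) $ i $ j = axis i 1 \<bullet> ((transpose B ** Q ** B) *v axis j 1)"
      by (simp add: inner_axis' matrix_vector_mult_basis column_def)
    also have "\<dots> = (B *v axis i 1) \<bullet> (Q *v (B *v axis j 1))"
      by (simp add: inner_transpose_mult del: transpose_matrix_vector flip: matrix_vector_mul_assoc)
    finally show ?thesis by (simp add: col)
  qed
  also have "f i \<bullet> (Q *v f j) = mat 1 $ i $ j" for i j
    using S(3) f by (auto simp: orth_def mat_def bij_betw_def inj_eq)
  finally have "transpose B ** Q ** B = mat 1" by (simp add: vec_eq_iff)
  then show thesis by (rule that)
qed

text \<open>The substitution x = B z with a Q-orthonormal \<open>B\<close> turns the quadratic form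
  into the squared norm, so \<open>U\<close> is the image of the unit ball. Moreover det(B)^2 det(Q)
  = 1.\<close>

lemma
  fixes Q :: "real ^ 'n::finite ^ 'n"
  assumes Q: "pos_def_mat Q"
  defines "U \<equiv> {x. x \<bullet> (Q *v x) \<le> 1}"
  shows det_pos_def: "det Q > 0"
    and bounded_ellipsoid: "bounded U"
    and measure_ellipsoid: "measure lborel U = unit_ball_vol CARD('n) / sqrt (det Q)"
proof -
  obtain B :: "real ^ 'n ^ 'n" where B: "transpose B ** Q ** B = mat 1"
    using pos_def_orthonormal_basis[OF Q] .
  have "(det B)\<^sup>2 * det Q = det (transpose B ** Q ** B)"
    by (simp add: det_mul det_transpose power2_eq_square)
  then have det: "(det B)\<^sup>2 * det Q = 1" by (simp add: B)
  then have "det B \<noteq> 0" by auto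
  then show detQ: "det Q > 0"
    using det zero_less_mult_pos[of "(det B)\<^sup>2" "det Q"] by simp
  have qB: "(B *v z) \<bullet> (Q *v (B *v z)) = z \<bullet> z" for z
  proof -
    have "(B *v z) \<bullet> (Q *v (B *v z)) = z \<bullet> ((transpose B ** Q ** B) *v z)"
      by (simp add: inner_transpose_mult del: transpose_matrix_vector flip: matrix_vector_mul_assoc)
    then show ?thesis by (simp add: B)
  qed
  have U: "(*v) B -` U = cball 0 1"
    by (auto simp: U_def qB norm_le_square)
  have UB: "U = (*v) B ` cball 0 1"
  proof -
    obtain B' where "B ** B' = mat 1"
      using \<open>det B \<noteq> 0\<close> by (auto simp: invertible_det_nz[symmetric] invertible_def)
    then have "surj ((*v) B)" using matrix_right_invertible_surjective by blast
    then show ?thesis by (simp add: U[symmetric] surj_image_vimage_eq)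
  qed
  have "compact U"
    unfolding UB by (intro compact_continuous_image) (auto intro: linear_continuous_on)
  then show "bounded U" by (rule compact_imp_bounded)
  have "emeasure lborel U = ennreal \<bar>det B\<bar> * emeasure lborel (cball (0 :: real ^ 'n) 1)"
    using emeasure_matrix_vimage[OF \<open>det B \<noteq> 0\<close>, of U] \<open>compact U\<close> U
    by (simp add: compact_imp_closed)
  then have "measure lborel U = \<bar>det B\<bar> * unit_ball_vol CARD('n)"
    by (simp add: measure_def emeasure_cball enn2real_mult)
  also have "\<bar>det B\<bar> = 1 / sqrt (det Q)"
  proof -
    have "sqrt ((det B)\<^sup>2 * det Q) = 1" by (simp add: det)
    then show ?thesis using detQ by (simp add: real_sqrt_mult field_simps)
  qed
  finally show "measure lborel U = unit_ball_vol CARD('n) / sqrt (det Q)" by simp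
qed

text \<open>For distinct x and y, the Q-orthogonal reflection along v = x - y exchanges them. It is
  an involution, which makes it measure preserving.\<close>

lemma reflection_exists:
  fixes Q :: "real ^ 'n::finite ^ 'n"
  assumes Q: "pos_def_mat Q" and eq: "x \<bullet> (Q *v x) = y \<bullet> (Q *v y)"
  obtains R where "R *v x = y" "R ** R = mat 1" "\<And>z. (R *v z) \<bullet> (Q *v (R *v z)) = z \<bullet> (Q *v z)"
proof (cases "x = y")
  case True
  then show thesis by (intro that[of "mat 1"]) auto
next
  case False
  have sym: "symmetric_mat Q" and pos: "\<And>x. x \<noteq> 0 \<Longrightarrow> x \<bullet> (Q *v x) > 0"
    using Q by (auto simp: pos_def_mat_def)
  define v where "v = x - y"
  define f where "f = (\<lambda>z. z - (2 * (v \<bullet> (Q *v z)) / (v \<bullet> (Q *v v))) *\<^sub>R v)"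
  have v: "v \<bullet> (Q *v v) \<noteq> 0" using pos[of v] False by (simp add: v_def)
  have lin: "linear f"
    unfolding f_def
    by (rule linearI) (simp_all add: matrix_vector_right_distrib matrix_vector_mult_scaleR
      inner_add_right scaleR_add_left add_divide_distrib algebra_simps)
  \<comment> \<open>Equality of the two values of the form is used here; it makes the reflection
    subtract exactly \<open>v\<close> from x.\<close>
  have "2 * (v \<bullet> (Q *v x)) = v \<bullet> (Q *v v)"
    using eq symmetric_mat_inner[OF sym, of x y]
    by (simp add: v_def matrix_vector_mult_diff_distrib inner_diff_left inner_diff_right)
  then have "f x = y" using v by (simp add: f_def v_def)
  have Qf: "v \<bullet> (Q *v f z) = - (v \<bullet> (Q *v z))" for z
    using v by (simp add: f_def matrix_vector_mult_diff_distrib matrix_vector_mult_scaleR inner_diff_right)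
  have ff: "f (f z) = z" for z
  proof -
    have "f (f z) = f z - (2 * (v \<bullet> (Q *v f z)) / (v \<bullet> (Q *v v))) *\<^sub>R v"
      by (simp add: f_def)
    then show ?thesis unfolding Qf by (simp add: f_def)
  qed
  have qf: "f z \<bullet> (Q *v f z) = z \<bullet> (Q *v z)" for z
  proof -
    define r where "r = 2 * (v \<bullet> (Q *v z)) / (v \<bullet> (Q *v v))"
    have "f z \<bullet> (Q *v f z) = z \<bullet> (Q *v f z) - r * (v \<bullet> (Q *v f z))"
      by (simp add: f_def r_def inner_diff_left)
    also have "\<dots> = z \<bullet> (Q *v z) - r * (z \<bullet> (Q *v v)) + r * (v \<bullet> (Q *v z))"
      unfolding Qf by (simp add: f_def r_def matrix_vector_mult_diff_distrib
        matrix_vector_mult_scaleR inner_diff_right)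
    finally show ?thesis by (simp add: symmetric_mat_inner[OF sym, of z v])
  qed
  show thesis
  proof
    show "matrix f *v x = y" using lin \<open>f x = y\<close> by simp
    show "matrix f ** matrix f = mat 1"
      using lin ff by (simp add: matrix_compose[symmetric] matrix_id_mat_1 o_def flip: id_def)
    show "(matrix f *v z) \<bullet> (Q *v (matrix f *v z)) = z \<bullet> (Q *v z)" for z
      using lin qf by simp
  qed
qed

lemma lborel_distr_involution:
  fixes R :: "real ^ 'n::finite ^ 'n"
  assumes R: "R ** R = mat 1"
  shows "distr lborel borel ((*v) R) = lborel"
proof (rule measure_eqI)
  have "R *v (R *v x) = x" for x by (simp add: matrix_vector_mul_assoc R)
  then show "emeasure (distr lborel borel ((*v) R)) X = emeasure lborel X"
    if "X \<in> sets (distr lborel borel ((*v) R))" for X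
    using that by (simp add: emeasure_distr emeasure_involution_vimage)
qed simp

subsection \<open>Moment matrices\<close>

lemma continuous_on_monomial_vec: "continuous_on UNIV (monomial_vec e)"
  unfolding monomial_vec_def by (intro continuous_intros)

lemma borel_measurable_monomial_vec [measurable]: "monomial_vec e \<in> borel_measurable borel"
  by (rule borel_measurable_continuous_onI) (rule continuous_on_monomial_vec)

lemma monomial_vec_scaleR:
  assumes "enumerates_exponents e k"
  shows "monomial_vec e (c *\<^sub>R x) = c ^ k *\<^sub>R monomial_vec e x"
proof -
  have "sum (e a) UNIV = k" for a
    using assms by (auto simp: enumerates_exponents_def bij_betw_def multi_exponents_def)
  then show ?thesis
    by (simp add: vec_eq_iff monomial_vec_def power_mult_distrib prod.distrib flip: power_sum)
qed

lemma inner_mult_inner_expand: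
  fixes v w m :: "real ^ 'm::finite"
  shows "(v \<bullet> m) * (w \<bullet> m) * c = (\<Sum>a\<in>UNIV. \<Sum>b\<in>UNIV. v $ a * w $ b * (m $ a * m $ b * c))"
  unfolding inner_vec_def inner_real_def sum_product
  unfolding sum_distrib_right
  by (intro sum.cong refl) simp

text \<open>With \<open>v\<close> and \<open>w\<close> read as coefficient vectors of forms, the
  moment matrix represents their L^2 pairing with weight \<open>p\<close>.\<close>

lemma moment_matrix_bilinear:
  assumes int: "\<And>a b. integrable lborel (\<lambda>y. monomial_vec e y $ a * monomial_vec e y $ b * p y)"
  shows "v \<bullet> (moment_matrix e p *v w)
    = (\<integral>y. (v \<bullet> monomial_vec e y) * (w \<bullet> monomial_vec e y) * p y \<partial>lborel)"
proof -
  have "(\<integral>y. (v \<bullet> monomial_vec e y) * (w \<bullet> monomial_vec e y) * p y \<partial>lborel)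
    = (\<integral>y. (\<Sum>a\<in>UNIV. \<Sum>b\<in>UNIV. v $ a * w $ b * (monomial_vec e y $ a * monomial_vec e y $ b * p y)) \<partial>lborel)"
    unfolding inner_mult_inner_expand ..
  also have "\<dots> = (\<Sum>a\<in>UNIV. \<Sum>b\<in>UNIV. v $ a * w $ b * moment_matrix e p $ a $ b)"
    using int by (simp add: moment_matrix_def)
  also have "\<dots> = v \<bullet> (moment_matrix e p *v w)"
    by (simp add: inner_vec_def matrix_vector_mult_def sum_distrib_left mult_ac)
  finally show ?thesis by simp
qed

lemma symmetric_moment_matrix: "symmetric_mat (moment_matrix e p)"
  by (simp add: symmetric_mat_def moment_matrix_def transpose_def mult.commute)

text \<open>If the form with coefficients \<open>v\<close> had zero weighted square integral, the
  open set where it is nonzero would be a null set, hence empty. Linear independence of monomials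
  then forces v = 0.\<close>

lemma pos_def_moment_matrix:
  fixes e :: "'m::finite \<Rightarrow> 'n::finite \<Rightarrow> nat"
  assumes "inj e"
    and int: "\<And>a b. integrable lborel (\<lambda>y. monomial_vec e y $ a * monomial_vec e y $ b * p y)"
    and p: "\<And>y. p y > 0"
  shows "pos_def_mat (moment_matrix e p)"
  unfolding pos_def_mat_def
proof (intro conjI symmetric_moment_matrix allI impI)
  fix v :: "real ^ 'm" assume "v \<noteq> 0"
  have eq: "v \<bullet> (moment_matrix e p *v v) = (\<integral>y. (v \<bullet> monomial_vec e y)\<^sup>2 * p y \<partial>lborel)"
    unfolding moment_matrix_bilinear[OF int] by (simp add: power2_eq_square)
  have i: "integrable lborel (\<lambda>y. (v \<bullet> monomial_vec e y)\<^sup>2 * p y)"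
  proof -
    have "integrable lborel (\<lambda>y. \<Sum>a\<in>UNIV. \<Sum>b\<in>UNIV. v $ a * v $ b * (monomial_vec e y $ a * monomial_vec e y $ b * p y))"
      using int by auto
    then show ?thesis
      unfolding power2_eq_square inner_mult_inner_expand .
  qed
  have "(\<integral>y. (v \<bullet> monomial_vec e y)\<^sup>2 * p y \<partial>lborel) \<noteq> 0"
  proof
    assume "(\<integral>y. (v \<bullet> monomial_vec e y)\<^sup>2 * p y \<partial>lborel) = 0"
    then have "AE y in lborel. (v \<bullet> monomial_vec e y)\<^sup>2 * p y = 0"
      using p by (subst (asm) integral_nonneg_eq_0_iff_AE[OF i]) (auto intro!: AE_I2 mult_nonneg_nonneg intro: less_imp_le)
    then have "AE y in lborel. y \<notin> {y. v \<bullet> monomial_vec e y \<noteq> 0}"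
      by eventually_elim (use p in \<open>auto simp: less_le\<close>)
    moreover have op: "open {y. v \<bullet> monomial_vec e y \<noteq> 0}"
      by (intro open_Collect_neq continuous_intros continuous_on_monomial_vec)
    ultimately have "{y. v \<bullet> monomial_vec e y \<noteq> 0} \<in> null_sets lborel"
      by (subst AE_iff_null_sets) auto
    then have "{y. v \<bullet> monomial_vec e y \<noteq> 0} = {}"
      using open_not_negligible[OF op] by (auto simp: negligible_iff_null_sets null_sets_completionI)
    then have "v = 0" using monomial_vec_lin_indep[OF \<open>inj e\<close>, of v] by auto
    with \<open>v \<noteq> 0\<close> show False by simp
  qed
  moreover have "(\<integral>y. (v \<bullet> monomial_vec e y)\<^sup>2 * p y \<partial>lborel) \<ge> 0"
    using p by (intro integral_nonneg_AE) (auto intro!: AE_I2 mult_nonneg_nonneg intro: less_imp_le)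
  ultimately show "v \<bullet> (moment_matrix e p *v v) > 0" unfolding eq by simp
qed

text \<open>Semidefiniteness of the inverse comes from x = M z, which turns the quadratic form of
  the inverse at x into that of \<open>M\<close> at z.\<close>

lemma
  fixes M :: "real ^ 'm::finite ^ 'm"
  assumes M: "pos_def_mat M"
  shows pos_def_mat_invertible: "invertible M"
    and pos_def_mat_inv: "M ** matrix_inv M = mat 1" "matrix_inv M ** M = mat 1"
    and pos_semidef_matrix_inv: "pos_semidef_mat (matrix_inv M)"
proof -
  have pos: "\<And>x. x \<noteq> 0 \<Longrightarrow> x \<bullet> (M *v x) > 0" and sym: "transpose M = M"
    using M by (auto simp: pos_def_mat_def symmetric_mat_def)
  have "\<forall>x. M *v x = 0 \<longrightarrow> x = 0"
    using pos by (metis inner_zero_right less_irrefl)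
  then show inv: "invertible M"
    by (simp add: invertible_left_inverse matrix_left_invertible_ker)
  then show 1: "M ** matrix_inv M = mat 1" and 2: "matrix_inv M ** M = mat 1"
    unfolding invertible_def matrix_inv_def by (metis (mono_tags, lifting) someI_ex)+
  have "transpose (matrix_inv M) ** M = mat 1"
    using arg_cong[OF 1, of transpose] by (simp add: matrix_transpose_mul sym)
  then have "transpose (matrix_inv M) = matrix_inv M"
    by (metis 1 matrix_mul_assoc matrix_mul_lid matrix_mul_rid)
  moreover have "x \<bullet> (matrix_inv M *v x) \<ge> 0" for x
  proof -
    define z where "z = matrix_inv M *v x"
    have "x = M *v z" by (simp add: z_def matrix_vector_mul_assoc 1)
    then have "x \<bullet> z = z \<bullet> (M *v z)" by (simp only: inner_commute)
    then show ?thesis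
      using pos[of z] unfolding z_def[symmetric] by (cases "z = 0") auto
  qed
  ultimately show "pos_semidef_mat (matrix_inv M)"
    by (simp add: pos_semidef_mat_def symmetric_mat_def)
qed

lemma moment_matrix_inv_invariant:
  fixes e :: "'m::finite \<Rightarrow> 'n::finite \<Rightarrow> nat" and R :: "real ^ 'n ^ 'n"
  assumes e: "enumerates_exponents e k"
    and int: "\<And>a b. integrable lborel (\<lambda>y. monomial_vec e y $ a * monomial_vec e y $ b * p y)"
    and p: "\<And>y. p y > 0" and [measurable]: "p \<in> borel_measurable borel"
    and R: "R ** R = mat 1" and pR: "\<And>y. p (R *v y) = p y"
  defines "N \<equiv> matrix_inv (moment_matrix e p)"
  shows "monomial_vec e (R *v x) \<bullet> (N *v monomial_vec e (R *v x))
    = monomial_vec e x \<bullet> (N *v monomial_vec e x)"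
proof -
  define M where "M = moment_matrix e p"
  have "inj e" using e by (simp add: enumerates_exponents_def bij_betw_def)
  then have M: "pos_def_mat M" unfolding M_def by (intro pos_def_moment_matrix int p)
  obtain S :: "real ^ 'm ^ 'm" where S: "\<And>x. monomial_vec e (R *v x) = S *v monomial_vec e x"
    using monomial_vec_linear_substitution[OF e, of R] by metis
  \<comment> \<open>Moving \<open>S\<close> onto the arguments replaces m(y) by m(R y) in the
    integral; the change of variables by \<open>R\<close> then removes it.\<close>
  have form: "v \<bullet> ((S ** M ** transpose S) *v w) = v \<bullet> (M *v w)" for v w
  proof -
    have "v \<bullet> ((S ** M ** transpose S) *v w) = (transpose S *v v) \<bullet> (M *v (transpose S *v w))"
      using inner_transpose_mult[of v "transpose S" "M *v (transpose S *v w)"]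
      by (simp add: transpose_transpose del: transpose_matrix_vector
          flip: matrix_vector_mul_assoc)
    also have "\<dots> = (\<integral>y. (v \<bullet> monomial_vec e (R *v y)) * (w \<bullet> monomial_vec e (R *v y)) * p (R *v y) \<partial>lborel)"
      unfolding M_def moment_matrix_bilinear[OF int] S pR
      using inner_transpose_mult[of "monomial_vec e _" S]
      by (simp add: inner_commute del: transpose_matrix_vector)
    also have "\<dots> = (\<integral>y. (v \<bullet> monomial_vec e y) * (w \<bullet> monomial_vec e y) * p y \<partial>distr lborel borel ((*v) R))"
      by (subst integral_distr) auto
    also have "\<dots> = v \<bullet> (M *v w)"
      by (simp add: lborel_distr_involution[OF R] M_def moment_matrix_bilinear[OF int])
    finally show ?thesis .
  qed
  have "S ** M ** transpose S = M"
  proof -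
    have "(S ** M ** transpose S) *v w = M *v w" for w
      using form by (metis vector_eq_ldot)
    then show ?thesis by (simp add: matrix_eq)
  qed
  \<comment> \<open>This exhibits a right inverse of the square matrix \<open>S\<close>, hence a
    left inverse. Multiplying the resulting identity by \<open>N\<close> from the left cancels
    \<open>M\<close> and leaves the invariance of \<open>N\<close>.\<close>
  then have "S ** (M ** transpose S ** N) = mat 1"
    by (metis M M_def N_def matrix_mul_assoc pos_def_mat_inv(1))
  then have "(M ** transpose S ** N) ** S = mat 1"
    by (simp add: matrix_left_right_inverse)
  then have "N ** (M ** (transpose S ** N ** S)) = N"
    by (simp add: matrix_mul_assoc[symmetric])
  then have SNS: "transpose S ** N ** S = N"
    using pos_def_mat_inv(2)[OF M] by (simp add: matrix_mul_assoc M_def N_def)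
  have "monomial_vec e (R *v x) \<bullet> (N *v monomial_vec e (R *v x))
    = monomial_vec e x \<bullet> ((transpose S ** N ** S) *v monomial_vec e x)"
    by (simp add: S inner_transpose_mult del: transpose_matrix_vector flip: matrix_vector_mul_assoc)
  then show ?thesis by (simp add: SNS)
qed

lemma moment_matrix_inv_trace:
  fixes e :: "'m::finite \<Rightarrow> 'n::finite \<Rightarrow> nat"
  assumes "inj e"
    and int: "\<And>a b. integrable lborel (\<lambda>y. monomial_vec e y $ a * monomial_vec e y $ b * p y)"
    and p: "\<And>y. p y > 0"
  shows "(\<integral>y. monomial_vec e y \<bullet> (matrix_inv (moment_matrix e p) *v monomial_vec e y) * p y \<partial>lborel)
    = CARD('m)"
proof -
  define M where "M = moment_matrix e p"
  define N where "N = matrix_inv M"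
  have M: "pos_def_mat M" unfolding M_def by (intro pos_def_moment_matrix assms)
  have "(\<integral>y. monomial_vec e y \<bullet> (N *v monomial_vec e y) * p y \<partial>lborel)
    = (\<integral>y. (\<Sum>a\<in>UNIV. \<Sum>b\<in>UNIV. N $ a $ b * (monomial_vec e y $ b * monomial_vec e y $ a * p y)) \<partial>lborel)"
    by (intro Bochner_Integration.integral_cong refl)
      (simp add: inner_vec_def matrix_vector_mult_def sum_distrib_left sum_distrib_right mult_ac)
  also have "\<dots> = (\<Sum>a\<in>UNIV. \<Sum>b\<in>UNIV. N $ a $ b * M $ b $ a)"
    using int by (simp add: M_def moment_matrix_def)
  also have "\<dots> = (\<Sum>a\<in>UNIV. (N ** M) $ a $ a)"
    by (simp add: matrix_matrix_mult_def)
  also have "\<dots> = CARD('m)"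
    using pos_def_mat_inv(2)[OF M] by (simp add: N_def mat_def)
  finally show ?thesis by (simp add: N_def M_def)
qed

text \<open>The Gaussian is abstracted to what the argument uses: a positive density with finite
  moments that depends on x only through the quadratic form and gives its k-th power the mean
  \<open>CARD('m)\<close>.\<close>

lemma gram_matrix_moment_matrix_inv:
  fixes e :: "'m::finite \<Rightarrow> 'n::finite \<Rightarrow> nat" and Q :: "real ^ 'n ^ 'n"
  assumes e: "enumerates_exponents e k" and k: "k > 0" and Q: "pos_def_mat Q"
    and int: "\<And>a b. integrable lborel (\<lambda>y. monomial_vec e y $ a * monomial_vec e y $ b * p y)"
    and p: "\<And>y. p y > 0" and p_meas: "p \<in> borel_measurable borel"
    and radial: "\<And>x y. x \<bullet> (Q *v x) = y \<bullet> (Q *v y) \<Longrightarrow> p x = p y"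
    and normalized: "(\<integral>y. (y \<bullet> (Q *v y)) ^ k * p y \<partial>lborel) = CARD('m)"
  shows "gram_matrix e (\<lambda>x. (x \<bullet> (Q *v x)) ^ k) (matrix_inv (moment_matrix e p))"
proof -
  define N where "N = matrix_inv (moment_matrix e p)"
  define q where "q = (\<lambda>x. x \<bullet> (Q *v x))"
  define K where "K = (\<lambda>x. monomial_vec e x \<bullet> (N *v monomial_vec e x))"
  have "inj e" using e by (simp add: enumerates_exponents_def bij_betw_def)
  have qpos: "q x > 0" if "x \<noteq> 0" for x using Q that by (simp add: q_def pos_def_mat_def)
  have q_scale: "q (c *\<^sub>R x) = c\<^sup>2 * q x" for c x
    by (simp add: q_def matrix_vector_mult_scaleR power2_eq_square)
  have K_scale: "K (c *\<^sub>R x) = (c\<^sup>2) ^ k * K x" for c x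
    by (simp add: K_def monomial_vec_scaleR[OF e] matrix_vector_mult_scaleR power2_eq_square power_mult_distrib)
  \<comment> \<open>reflections act transitively on the level sets of \<open>q\<close>\<close>
  have K_cong: "K x = K y" if "q x = q y" for x y
  proof -
    obtain R where R: "R *v x = y" "R ** R = mat 1" "\<And>z. q (R *v z) = q z"
      using reflection_exists[OF Q, of x y] \<open>q x = q y\<close> unfolding q_def by metis
    have "p (R *v z) = p z" for z
      by (rule radial) (use R(3) in \<open>simp add: q_def\<close>)
    from moment_matrix_inv_invariant[OF e int p p_meas R(2) this, of x] show ?thesis
      by (simp add: K_def N_def R(1))
  qed
  \<comment> \<open>Any nonzero reference vector determines the constant \<open>C\<close>.\<close>
  obtain u :: "real ^ 'n" where u: "u \<noteq> 0" by (metis axis_eq_0_iff zero_neq_one)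
  define C where "C = K u / q u ^ k"
  have K: "K x = C * q x ^ k" for x
  proof (cases "x = 0")
    case True
    then have "K x = 0" using K_scale[of 0 x] k by (simp add: zero_power)
    then show ?thesis using True k by (simp add: q_def)
  next
    case False
    \<comment> \<open>This rescaling moves \<open>u\<close> to the level set of x, after which
      homogeneity of \<open>K\<close> gives its value.\<close>
    have "q x = q (sqrt (q x / q u) *\<^sub>R u)"
      using qpos[OF False] qpos[OF u] by (simp add: q_scale)
    from K_cong[OF this] show ?thesis
      using qpos[OF False] qpos[OF u] by (simp add: K_scale C_def power_divide)
  qed
  have "(\<integral>y. K y * p y \<partial>lborel) = CARD('m)"
    unfolding K_def N_def by (rule moment_matrix_inv_trace[OF \<open>inj e\<close> int p])
  then have "C * CARD('m) = CARD('m)"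
    using normalized by (simp add: K q_def mult.assoc)
  then have "C = 1" by simp
  then have "q x ^ k = K x" for x by (simp add: K)
  moreover have "pos_semidef_mat N"
    unfolding N_def by (intro pos_semidef_matrix_inv pos_def_moment_matrix \<open>inj e\<close> int p)
  ultimately show ?thesis by (simp add: gram_matrix_def q_def K_def N_def)
qed

subsection \<open>Gaussian and Gaussian-like densities\<close>

lemma integrable_continuous_bounded_sublevel:
  fixes g h :: "'a::euclidean_space \<Rightarrow> real"
  assumes g: "continuous_on UNIV g" and h: "continuous_on UNIV h" and bounded: "bounded {x. g x \<le> t}"
  shows "integrable lborel (\<lambda>x. h x * indicator {x. g x \<le> t} x)"
proof -
  have "compact {x. g x \<le> t}"
    using bounded g by (simp add: compact_eq_bounded_closed closed_Collect_le)
  from borel_integrable_compact[OF this, of h] h show ?thesis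
    by (auto simp: indicator_def if_distrib continuous_on_subset mult.commute cong: if_cong)
qed

text \<open>In the quotient by \<open>Z\<close> the power k^(n/D) cancels. It will be used with g =
  q, D = 2 and with g = q^s, D = 2 s; the first factor of the mean is the same in both
  cases.\<close>

lemma
  fixes g h :: "'a::euclidean_space \<Rightarrow> real"
  assumes cont: "continuous_on UNIV g" "continuous_on UNIV h"
    and g: "\<And>c x. c > 0 \<Longrightarrow> g (c *\<^sub>R x) = c ^ D * g x" and D: "D > 0"
    and h: "\<And>c x. c > 0 \<Longrightarrow> h (c *\<^sub>R x) = c ^ r * h x"
    and nonneg: "\<And>x. g x \<ge> 0" and k: "k > 0"
    and bounded: "bounded {x. g x \<le> 1}"
  defines "Z \<equiv> (\<integral>x. exp (- k * g x) \<partial>lborel)"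
  shows integrable_exp_neg_homogeneous_density: "integrable lborel (\<lambda>x. h x * (exp (- k * g x) / Z))"
    and exp_neg_homogeneous_mean: "(\<integral>x. h x * (exp (- k * g x) / Z) \<partial>lborel)
    = (\<integral>x. h x * indicator {x. g x \<le> 1} x \<partial>lborel) / measure lborel {x. g x \<le> 1}
      * (Gamma ((r + DIM('a)) / D + 1) / Gamma (DIM('a) / D + 1) / k powr (r / D))"
    and exp_neg_homogeneous_normalization:
      "Z = measure lborel {x. g x \<le> 1} * (Gamma (DIM('a) / D + 1) / k powr (DIM('a) / D))"
proof -
  have [measurable]: "g \<in> borel_measurable borel" "h \<in> borel_measurable borel"
    using cont by (auto intro: borel_measurable_continuous_onI)
  have int1: "integrable lborel (\<lambda>x. 1 * indicator {x. g x \<le> 1} x :: real)"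
    by (intro integrable_continuous_bounded_sublevel cont bounded continuous_on_const)
  have inth: "integrable lborel (\<lambda>x. h x * indicator {x. g x \<le> 1} x)"
    by (intro integrable_continuous_bounded_sublevel cont bounded)
  show i: "integrable lborel (\<lambda>x. h x * (exp (- k * g x) / Z))"
    using integrable_exp_neg_homogeneous[of g h, OF _ _ g D h nonneg k inth] by simp
  show Z: "Z = measure lborel {x. g x \<le> 1} * (Gamma (DIM('a) / D + 1) / k powr (DIM('a) / D))"
    unfolding Z_def
    using integral_exp_neg_homogeneous[of g "\<lambda>_. 1" D 0 k, OF _ _ g D _ nonneg k int1] by simp
  have num: "(\<integral>x. h x * exp (- k * g x) \<partial>lborel)
    = (\<integral>x. h x * indicator {x. g x \<le> 1} x \<partial>lborel)
      * (Gamma ((r + DIM('a)) / D + 1) / k powr ((r + DIM('a)) / D))"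
    by (rule integral_exp_neg_homogeneous[of g h, OF _ _ g D h nonneg k inth]) auto
  have "(\<integral>x. h x * (exp (- k * g x) / Z) \<partial>lborel) = (\<integral>x. h x * exp (- k * g x) \<partial>lborel) / Z"
    by simp
  also have "\<dots> = (\<integral>x. h x * indicator {x. g x \<le> 1} x \<partial>lborel) / measure lborel {x. g x \<le> 1}
      * (Gamma ((r + DIM('a)) / D + 1) / Gamma (DIM('a) / D + 1) / k powr (r / D))"
    unfolding num unfolding Z using k by (simp add: add_divide_distrib powr_add)
  finally show "(\<integral>x. h x * (exp (- k * g x) / Z) \<partial>lborel)
    = (\<integral>x. h x * indicator {x. g x \<le> 1} x \<partial>lborel) / measure lborel {x. g x \<le> 1}
      * (Gamma ((r + DIM('a)) / D + 1) / Gamma (DIM('a) / D + 1) / k powr (r / D))" .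
qed

section \<open>The constants of the Gaussian density\<close>

lemma pochhammer_shift:
  fixes x :: real
  shows "pochhammer (x + 1) s * x = pochhammer x s * (x + s)"
  by (metis mult.commute pochhammer_rec pochhammer_rec')

lemma gauss_sigma_eq:
  "gauss_sigma TYPE('n::finite) (2 * s) = (real ((s + CARD('n) - 1) choose (CARD('n) - 1))
    / (2 ^ s * pochhammer (real CARD('n) / 2) s)) powr (1 / real (2 * s))"
  by (simp add: gauss_sigma_def pochhammer_prod atLeast0LessThan power_mult)

lemma gauss_sigma_pos: "gauss_sigma TYPE('n::finite) d > 0"
proof -
  have "(\<Prod>i<d div 2. real CARD('n) / 2 + real i) > 0"
    by (intro prod_pos) (auto intro: add_pos_nonneg)
  moreover have "real ((d div 2 + CARD('n) - 1) choose (CARD('n) - 1)) > 0"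
    by (auto simp: not_less intro: diff_le_mono)
  ultimately show ?thesis
    unfolding gauss_sigma_def powr_gt_zero by (metis divide_pos_pos less_irrefl mult_pos_pos
      real_sqrt_gt_zero zero_less_numeral zero_less_power)
qed

text \<open>With l = 1/(2 sigma_d^2) this is 1/l^s, the form in which sigma_d enters the moments of
  degree 2 s.\<close>

lemma gauss_sigma_power:
  assumes "s > 0"
  shows "(2 * (gauss_sigma TYPE('n::finite) (2 * s))\<^sup>2) ^ s
    = real ((s + CARD('n) - 1) choose (CARD('n) - 1)) / pochhammer (CARD('n) / 2) s"
proof -
  define B where "B = real ((s + CARD('n) - 1) choose (CARD('n) - 1))"
  define P where "P = pochhammer (real CARD('n) / 2) s"
  have "P > 0" by (simp add: P_def pochhammer_pos)
  moreover have "B \<ge> 0" by (simp add: B_def)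
  ultimately have nonneg: "B / (2 ^ s * P) \<ge> 0" by simp
  have "(gauss_sigma TYPE('n) (2 * s)) ^ (2 * s) = (gauss_sigma TYPE('n) (2 * s)) powr real (2 * s)"
    by (rule powr_realpow[symmetric]) (rule gauss_sigma_pos)
  also have "\<dots> = (B / (2 ^ s * P)) powr 1"
    unfolding gauss_sigma_eq B_def[symmetric] P_def[symmetric] powr_powr using assms by simp
  also have "\<dots> = B / (2 ^ s * P)" using nonneg by (rule powr_one)
  finally show ?thesis
    unfolding B_def[symmetric] P_def[symmetric] power_mult_distrib by (simp add: power_mult)
qed

lemma quadratic_form_continuous: "continuous_on UNIV (\<lambda>x. x \<bullet> (Q *v x))"
  for Q :: "real ^ 'n::finite ^ 'n"
  by (intro continuous_intros linear_continuous_on) auto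

lemma quadratic_form_scaleR: "(c *\<^sub>R x) \<bullet> (Q *v (c *\<^sub>R x)) = c\<^sup>2 * (x \<bullet> (Q *v x))"
  for Q :: "real ^ 'n::finite ^ 'n"
  by (simp add: matrix_vector_mult_scaleR power2_eq_square)

lemma pos_def_mat_nonneg: "pos_def_mat Q \<Longrightarrow> x \<bullet> (Q *v x) \<ge> 0"
  by (cases "x = 0") (auto simp: pos_def_mat_def less_imp_le)

text \<open>The total mass is the ellipsoid volume times Gamma(n/2 + 1)/k^(n/2). The Gamma value
  cancels against the one in the unit ball volume, leaving the classical prefactor.\<close>

lemma gauss_density_eq:
  fixes Q :: "real ^ 'n::finite ^ 'n" and d :: nat
  assumes Q: "pos_def_mat Q"
  defines "k \<equiv> 1 / (2 * (gauss_sigma TYPE('n) d)\<^sup>2)"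
  shows "gauss_density d Q y
    = exp (- k * (y \<bullet> (Q *v y))) / (\<integral>x. exp (- k * (x \<bullet> (Q *v x))) \<partial>lborel)"
proof -
  define \<sigma> where "\<sigma> = gauss_sigma TYPE('n) d"
  have \<sigma>: "\<sigma> > 0" by (simp add: \<sigma>_def gauss_sigma_pos)
  have k: "k > 0" using \<sigma> by (simp add: k_def \<sigma>_def)
  have "1 / k powr (CARD('n) / 2) = (2 * \<sigma>\<^sup>2) powr (CARD('n) / 2)"
    unfolding k_def \<sigma>_def[symmetric] by (simp only: powr_divide powr_one_eq_one div_by_1 divide_divide_eq_right mult_1)
  also have "\<dots> = 2 powr (CARD('n) / 2) * (\<sigma> powr 2) powr (CARD('n) / 2)"
    using \<sigma> by (simp only: powr_mult powr_numeral)
  also have "(\<sigma> powr 2) powr (CARD('n) / 2) = \<sigma> ^ CARD('n)"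
    using \<sigma> by (simp only: powr_powr) (simp add: powr_realpow)
  finally have kpow: "1 / k powr (CARD('n) / 2) = 2 powr (CARD('n) / 2) * \<sigma> ^ CARD('n)" .
  have "sqrt ((2 * pi) ^ CARD('n)) = ((2 * pi) powr CARD('n)) powr (1 / 2)"
    by (simp only: powr_half_sqrt powr_ge_zero) (simp add: powr_realpow)
  also have "\<dots> = 2 powr (CARD('n) / 2) * pi powr (CARD('n) / 2)"
    by (simp only: powr_powr) (simp add: powr_mult)
  finally have pipow: "sqrt ((2 * pi) ^ CARD('n)) = 2 powr (CARD('n) / 2) * pi powr (CARD('n) / 2)" .
  have G: "Gamma (real CARD('n) / 2 + 1) \<noteq> 0"
    using Gamma_real_pos[of "real CARD('n) / 2 + 1"] by (intro notI) simp
  have "(\<integral>x. exp (- k * (x \<bullet> (Q *v x))) \<partial>lborel)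
    = measure lborel {x. x \<bullet> (Q *v x) \<le> 1} * (Gamma (CARD('n) / 2 + 1) / k powr (CARD('n) / 2))"
    using exp_neg_homogeneous_normalization[OF quadratic_form_continuous continuous_on_const
        quadratic_form_scaleR _ _ pos_def_mat_nonneg[OF Q] k bounded_ellipsoid[OF Q], of 1 0]
    by simp
  also have "\<dots> = pi powr (CARD('n) / 2) / sqrt (det Q) * (1 / k powr (CARD('n) / 2))"
    unfolding measure_ellipsoid[OF Q] unit_ball_vol_def using G by simp
  also have "\<dots> = \<sigma> ^ CARD('n) * sqrt ((2 * pi) ^ CARD('n)) / sqrt (det Q)"
    unfolding kpow pipow by simp
  finally show ?thesis
    by (simp add: gauss_density_def \<sigma>_def[symmetric] k_def)
qed

text \<open>This relates the binomial that defines k to the number of monomials, which occurs in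
  sigma_d.\<close>

lemma binomial_times_shift:
  assumes "s > 0" "n > 0"
  shows "real ((s + n - 1) choose n) * n = s * real ((s + n - 1) choose (n - 1))"
proof -
  obtain c where n: "n = Suc c" using \<open>n > 0\<close> gr0_implies_Suc by blast
  have "Suc c * ((s + c) choose Suc c) = s * ((s + c) choose c)"
    using binomial_absorption[of c "s + c"] binomial_absorb_comp[of "s + c" c] by simp
  then show ?thesis unfolding n of_nat_mult[symmetric] by (simp add: mult.commute)
qed

text \<open>\<open>I\<close> is the mean of \<open>h\<close> over {q \<le> 1} times B (2 s + n)/n.
  The Gaussian scalar is a quotient of rising factorials times B, the Gaussian-like one is (n/(2 s)
  + 1)/k, and both reduce to this factor.\<close>

lemma
  fixes Q :: "real ^ 'n::finite ^ 'n" and h :: "real ^ 'n \<Rightarrow> real"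
  assumes Q: "pos_def_mat Q" and s: "s > 0"
    and cont: "continuous_on UNIV h" and h: "\<And>c x. c > 0 \<Longrightarrow> h (c *\<^sub>R x) = c ^ (2 * s) * h x"
  defines "q \<equiv> \<lambda>x. x \<bullet> (Q *v x)"
    and "k \<equiv> gauss_like_k TYPE('n) (2 * s)"
  defines "I \<equiv> (\<integral>x. h x * indicator {x. q x \<le> 1} x \<partial>lborel) / measure lborel {x. q x \<le> 1}
      * (real ((s + CARD('n) - 1) choose (CARD('n) - 1)) * (2 * s + CARD('n)) / CARD('n))"
  shows integrable_gauss_moment: "integrable lborel (\<lambda>x. h x * gauss_density (2 * s) Q x)"
    and gauss_moment: "(\<integral>x. h x * gauss_density (2 * s) Q x \<partial>lborel) = I"
    and gauss_like_moment: "(\<integral>x. h x * (exp (- k * q x ^ s) / (\<integral>z. exp (- k * q z ^ s) \<partial>lborel)) \<partial>lborel) = I"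
proof -
  define \<sigma> where "\<sigma> = gauss_sigma TYPE('n) (2 * s)"
  define l where "l = 1 / (2 * \<sigma>\<^sup>2)"
  define B where "B = real ((s + CARD('n) - 1) choose (CARD('n) - 1))"
  have \<sigma>: "\<sigma> > 0" by (simp add: \<sigma>_def gauss_sigma_pos)
  have l: "l > 0" using \<sigma> by (simp add: l_def)
  have n: "real CARD('n) > 0" by simp
  have qc: "continuous_on UNIV q" unfolding q_def by (rule quadratic_form_continuous)
  have q0: "q x \<ge> 0" for x unfolding q_def by (rule pos_def_mat_nonneg[OF Q])
  have q2: "q (c *\<^sub>R x) = c\<^sup>2 * q x" for c x unfolding q_def by (rule quadratic_form_scaleR)
  have bdd: "bounded {x. q x \<le> 1}" unfolding q_def by (rule bounded_ellipsoid[OF Q])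
  have gd: "gauss_density (2 * s) Q x = exp (- l * q x) / (\<integral>z. exp (- l * q z) \<partial>lborel)" for x
    unfolding l_def \<sigma>_def q_def by (rule gauss_density_eq[OF Q])
  show "integrable lborel (\<lambda>x. h x * gauss_density (2 * s) Q x)"
    unfolding gd by (rule integrable_exp_neg_homogeneous_density[OF qc cont q2 _ h q0 l bdd]) auto
  have "Gamma (real (2 * s + CARD('n)) / 2 + 1) / Gamma (CARD('n) / 2 + 1) / l powr (real (2 * s) / 2)
    = B * (2 * s + CARD('n)) / CARD('n)"
  proof -
    define P where "P = pochhammer (real CARD('n) / 2) s"
    have P: "P > 0" by (simp add: P_def pochhammer_pos)
    have "l powr (real (2 * s) / 2) = l ^ s" using l by (simp add: powr_realpow)
    moreover have "1 / l ^ s = B / P"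
      using gauss_sigma_power[OF s, where 'n = 'n]
      by (simp add: l_def B_def P_def \<sigma>_def power_divide)
    moreover have "Gamma (real (2 * s + CARD('n)) / 2 + 1) / Gamma (CARD('n) / 2 + 1)
      = pochhammer (real CARD('n) / 2 + 1) s"
      by (subst pochhammer_Gamma) (auto simp: add_divide_distrib add_ac dest!: nonpos_Ints_nonpos)
    \<comment> \<open>Raising the base from n/2 to n/2 + 1 trades the factor n/2 for n/2 + s, whose
      quotient is (2 s + n)/n.\<close>
    moreover have "pochhammer (real CARD('n) / 2 + 1) s = P * (2 * s + CARD('n)) / CARD('n)"
      using pochhammer_shift[of "CARD('n) / 2" s] n by (simp add: P_def field_simps)
    ultimately have "Gamma (real (2 * s + CARD('n)) / 2 + 1) / Gamma (CARD('n) / 2 + 1) / l powr (real (2 * s) / 2)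
      = P * (2 * s + CARD('n)) / CARD('n) * (B / P)"
      by (metis divide_inverse mult_1)
    then show ?thesis using P by simp
  qed
  then show "(\<integral>x. h x * gauss_density (2 * s) Q x \<partial>lborel) = I"
    using exp_neg_homogeneous_mean[OF qc cont q2 _ h q0 l bdd]
    by (simp add: gd I_def B_def)
  have U: "{x. q x ^ s \<le> 1} = {x. q x \<le> 1}"
    using s q0 by (simp add: power_le_one_iff)
  have qs: "q (c *\<^sub>R x) ^ s = c ^ (2 * s) * q x ^ s" for c x
    by (simp add: q2 power_mult_distrib power_mult)
  have k: "k > 0" using s by (simp add: k_def gauss_like_k_def)
  have "Gamma (real (2 * s + CARD('n)) / real (2 * s) + 1) / Gamma (CARD('n) / real (2 * s) + 1)
      / k powr (real (2 * s) / real (2 * s)) = B * (2 * s + CARD('n)) / CARD('n)"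
  proof -
    \<comment> \<open>For r = D = 2 s the Gamma arguments are \<open>a + 1\<close> and
      \<open>a\<close>, so the functional equation reduces their quotient to
      \<open>a\<close>.\<close>
    define a where "a = real CARD('n) / real (2 * s) + 1"
    have a: "a > 0" by (simp add: a_def add_nonneg_pos)
    have arg: "real (2 * s + CARD('n)) / real (2 * s) = a" using s by (simp add: a_def field_simps)
    have "Gamma (a + 1) = a * Gamma a"
      using a by (intro Gamma_plus1) (auto dest!: nonpos_Ints_nonpos)
    moreover have "Gamma a > 0" using a by (rule Gamma_real_pos)
    moreover have "a / k = B * (2 * s + CARD('n)) / CARD('n)"
    proof -
      define C where "C = real ((s + CARD('n) - 1) choose CARD('n))"
      have "C = s * B / CARD('n)"
        using binomial_times_shift[OF s zero_less_card_finite[where 'a = 'n]] n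
        by (simp add: C_def B_def eq_divide_eq)
      moreover have "1 / k = 2 * C" by (simp add: k_def gauss_like_k_def C_def)
      moreover have "a = (2 * s + CARD('n)) / (2 * s)" using s by (simp add: a_def field_simps)
      ultimately have "a * (1 / k) = (2 * s + CARD('n)) / (2 * s) * (2 * (s * B / CARD('n)))"
        by simp
      then show ?thesis using s by (simp add: mult.commute)
    qed
    ultimately have "Gamma (a + 1) / Gamma a / k powr 1 = B * (2 * s + CARD('n)) / CARD('n)"
      using k by simp
    moreover have "real (2 * s) / real (2 * s) = 1" using s by simp
    ultimately show ?thesis unfolding arg a_def[symmetric] by (simp only:)
  qed
  note factor = this
  have "2 * s > 0" using s by simp
  moreover have "bounded {x. q x ^ s \<le> 1}" using bdd by (simp only: U)
  ultimately show "(\<integral>x. h x * (exp (- k * q x ^ s) / (\<integral>z. exp (- k * q z ^ s) \<partial>lborel)) \<partial>lborel) = I"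
    unfolding I_def B_def[symmetric] factor[symmetric] U[symmetric]
    using exp_neg_homogeneous_mean[OF continuous_on_power[OF qc] cont qs _ h zero_le_power[OF q0] k]
    by (simp only: DIM_cart DIM_real mult_1_right)
qed

text \<open>The mean of q^s over {q \<le> 1} is n/(2 s + n), which cancels the factor (2 s + n)/n
  and leaves the number of monomials.\<close>

lemma gauss_moment_quadratic_form_power:
  fixes Q :: "real ^ 'n::finite ^ 'n"
  assumes Q: "pos_def_mat Q" and s: "s > 0"
  shows "(\<integral>x. (x \<bullet> (Q *v x)) ^ s * gauss_density (2 * s) Q x \<partial>lborel)
    = real ((s + CARD('n) - 1) choose (CARD('n) - 1))"
proof -
  define q where "q = (\<lambda>x. x \<bullet> (Q *v x))"
  have qc: "continuous_on UNIV q" unfolding q_def by (rule quadratic_form_continuous)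
  then have [measurable]: "q \<in> borel_measurable borel" by (rule borel_measurable_continuous_onI)
  have q0: "q x \<ge> 0" for x unfolding q_def by (rule pos_def_mat_nonneg[OF Q])
  have q2: "q (c *\<^sub>R x) ^ s = c ^ (2 * s) * q x ^ s" for c x
    unfolding q_def quadratic_form_scaleR by (simp add: power_mult_distrib power_mult)
  have U: "{x. q x ^ s \<le> 1} = {x. q x \<le> 1}"
    using s q0 by (simp add: power_le_one_iff)
  have bdd: "bounded {x. q x \<le> 1}" unfolding q_def by (rule bounded_ellipsoid[OF Q])
  have vol: "measure lborel {x. q x \<le> 1} > 0"
    unfolding q_def by (simp add: measure_ellipsoid[OF Q] det_pos_def[OF Q])
  have "(\<integral>x. q x ^ s * indicator {x. q x \<le> 1} x \<partial>lborel)
    = measure lborel {x. q x \<le> 1} * (CARD('n) / (2 * s + CARD('n)))"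
    using integral_homogeneous_sublevel[of "\<lambda>x. q x ^ s" "2 * s"] s q0 emeasure_bounded_finite[OF bdd]
    by (simp add: U q2)
  then show ?thesis
    using gauss_moment[OF Q s, of "\<lambda>x. q x ^ s"] vol qc q2 s
    by (simp add: q_def[symmetric] continuous_on_power) (simp add: q_def)
qed

theorem theorem1p5:
  fixes Q :: "real ^ 'n::finite ^ 'n"
    and d :: nat
    and e :: "'m::finite \<Rightarrow> 'n \<Rightarrow> nat"
  assumes "pos_def_mat Q"
    and "d \<ge> 2" and "even d"
    and "enumerates_exponents e (d div 2)"
  shows "invertible (gauss_moment_matrix e d Q)
    \<and> gram_matrix e (\<lambda>x. (x \<bullet> (Q *v x)) ^ (d div 2)) (matrix_inv (gauss_moment_matrix e d Q))
    \<and> (\<forall>G. gram_matrix e (\<lambda>x. (x \<bullet> (Q *v x)) ^ (d div 2)) G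
           \<longrightarrow> gauss_moment_matrix e d Q = gauss_like_moment_matrix e d G)"
proof -
  note Q = \<open>pos_def_mat Q\<close>
  define s where "s = d div 2"
  have s: "s > 0" using assms(2) by (simp add: s_def)
  have d: "d = 2 * s" unfolding s_def by (rule dvd_mult_div_cancel[symmetric]) (rule assms(3))
  have e: "enumerates_exponents e s" using assms(4) by (simp add: s_def)
  have "inj e" using e by (simp add: enumerates_exponents_def bij_betw_def)
  \<comment> \<open>An enumeration fixes the matrix size, so the trace of the identity matches the
    binomial in the mean of q^s.\<close>
  have card: "CARD('m) = (s + CARD('n) - 1) choose (CARD('n) - 1)"
    by (rule iffD1[OF ex_enumerates_exponents]) (rule exI, rule e)
  have hom: "monomial_vec e (c *\<^sub>R x) $ a * monomial_vec e (c *\<^sub>R x) $ b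
      = c ^ (2 * s) * (monomial_vec e x $ a * monomial_vec e x $ b)" for c x a b
    by (simp add: monomial_vec_scaleR[OF e] mult_2 power_add)
  have cont: "continuous_on UNIV (\<lambda>x. monomial_vec e x $ a * monomial_vec e x $ b)" for a b
    by (intro continuous_on_mult continuous_on_component continuous_on_monomial_vec)
  have pos: "gauss_density d Q y > 0" for y
    by (simp add: gauss_density_def det_pos_def[OF Q] gauss_sigma_pos)
  have "gauss_sigma TYPE('n) d \<noteq> 0" using gauss_sigma_pos[where 'n = 'n, of d] by simp
  then have meas: "gauss_density d Q \<in> borel_measurable borel"
    unfolding gauss_density_def[abs_def]
    by (intro borel_measurable_continuous_onI continuous_intros quadratic_form_continuous) auto
  have int: "integrable lborel (\<lambda>y. monomial_vec e y $ a * monomial_vec e y $ b * gauss_density d Q y)" for a b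
    unfolding d by (rule integrable_gauss_moment[OF Q s cont hom])
  have "invertible (gauss_moment_matrix e d Q)"
    unfolding gauss_moment_matrix_def
    by (rule pos_def_mat_invertible, rule pos_def_moment_matrix) (rule \<open>inj e\<close> int pos)+
  moreover have "gram_matrix e (\<lambda>x. (x \<bullet> (Q *v x)) ^ s) (matrix_inv (gauss_moment_matrix e d Q))"
    unfolding gauss_moment_matrix_def
  proof (rule gram_matrix_moment_matrix_inv[OF e s Q int pos meas])
    show "gauss_density d Q x = gauss_density d Q y" if "x \<bullet> (Q *v x) = y \<bullet> (Q *v y)" for x y
      by (simp add: gauss_density_def that)
    show "(\<integral>y. (y \<bullet> (Q *v y)) ^ s * gauss_density d Q y \<partial>lborel) = CARD('m)"
      unfolding d card by (rule gauss_moment_quadratic_form_power[OF Q s])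
  qed
  moreover have "gauss_moment_matrix e d Q = gauss_like_moment_matrix e d G"
    if "gram_matrix e (\<lambda>x. (x \<bullet> (Q *v x)) ^ s) G" for G
  proof -
    \<comment> \<open>The Gaussian-like density sees \<open>G\<close> only through its form, so the
      equality holds for every Gram matrix of q^s and not just for the inverse above.\<close>
    have "monomial_vec e x \<bullet> (G *v monomial_vec e x) = (x \<bullet> (Q *v x)) ^ s" for x
      using that by (simp add: gram_matrix_def)
    then have density: "gauss_like_density e d G y = exp (- gauss_like_k TYPE('n) (2 * s) * (y \<bullet> (Q *v y)) ^ s)
        / (\<integral>z. exp (- gauss_like_k TYPE('n) (2 * s) * (z \<bullet> (Q *v z)) ^ s) \<partial>lborel)" for y
      by (simp only: gauss_like_density_def Let_def d)
    have "gauss_moment_matrix e d Q $ a $ b = gauss_like_moment_matrix e d G $ a $ b" for a b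
      unfolding gauss_moment_matrix_def gauss_like_moment_matrix_def moment_matrix_def vec_lambda_beta density
      unfolding d
      by (rule trans[OF gauss_moment[OF Q s cont hom] gauss_like_moment[OF Q s cont hom, symmetric]])
    then show ?thesis by (simp add: vec_eq_iff)
  qed
  ultimately show ?thesis unfolding s_def by (intro conjI allI impI)
qed

end
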